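(* Let $d\ge1$ and let $E_1,E_2\subset[1,2]$ be nonempty with upper Minkowski dimensions $\dim_M(E_i)=\beta_i$, $i=1,2$. Let $m$ be an $a$-admissible bilinear multiplier up to order $2$ on $\mathbb{R}^{2d}$, and assume $2a>d+\beta_1+\beta_2$. If $s_1,s_2\ge0$ satisfy $s_1+s_2<\frac{2a-d-\beta_1-\beta_2}{2}$, then $$\|\mathcal{A}^{(2)}_{m,E_1,E_2}(f,g)\|_{L^2}\lesssim\|f\|_{H^{-s_1}}\|g\|_{H^{-s_2}}.$$
   Context: All functions are on $\mathbb{R}^d$. Operators are initially defined for $f,g\in C_0^\infty(\mathbb{R}^d)$, and $A\lesssim B$ means $A\le CB$ with $C$ independent of $f,g$. The Fourier transform is $\hat f(\xi)=\int f(x)e^{-2\pi i x\cdot\xi}\,dx$. Admissible multipliers: for $k\ge 0$, a bounded function $m:\mathbb{R}^{2d}\to\mathbb{C}$ is $a$-admissible up to order $k$ if $m\in C^k(\mathbb{R}^{2d})$, $a>\frac d2$, and $|\partial^\alpha m(\xi,\eta)|\lesssim_\alpha (1+|\xi|+|\eta|)^{-a}$ for all multi-indices $\alpha$ with $|\alpha|\le k$ and all $\xi,\eta\in\mathbb{R}^d$. The biparameter operators are $$T_{m_{t_1,t_2}}(f,g)(x)=\int_{\mathbb{R}^{2d}}\hat f(\xi)\hat g(\eta)m(t_1\xi,t_2\eta)e^{2\pi ix\cdot(\xi+\eta)}\,d\xi d\eta,$$ $$\mathcal{A}^{(2)}_{m,E_1,E_2}(f,g)(x)=\sup_{t_1\in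 E_1,\,t_2\in E_2}|T_{m_{t_1,t_2}}(f,g)(x)|.$$ Upper Minkowski dimension: $\dim_M(E)=\limsup_{\delta\to0}\frac{\log N(E,\delta)}{\log(1/\delta)}$, where $N(E,\delta)$ is the minimal number of closed intervals of length $\delta$ needed to cover $E$. For $s\ge0$, $\|f\|_{H^{-s}}=\|(1+|\xi|^2)^{-s/2}\hat f(\xi)\|_{L^2_\xi}$. *)

theory Defs
  imports "HOL-Analysis.Analysis"
begin

definition partial_derivative ::
    "'a::euclidean_space \<Rightarrow> ('a \<Rightarrow> complex) \<Rightarrow> 'a \<Rightarrow> complex" where
  "partial_derivative b f x = vector_derivative (\<lambda>h::real. f (x + h *\<^sub>R b)) (at 0)"

text \<open>A list of basis vectors encodes a multi-index together with an order of
  differentiation; its length is the order of the multi-index. For functions of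
  class \<open>C\<^sup>k\<close> and lists of length at most \<open>k\<close>, the order of differentiation
  does not matter.\<close>

fun iterated_partial ::
    "'a::euclidean_space list \<Rightarrow> ('a \<Rightarrow> complex) \<Rightarrow> 'a \<Rightarrow> complex" where
  "iterated_partial [] f = f"
| "iterated_partial (b # bs) f = partial_derivative b (iterated_partial bs f)"

fun C_k :: "nat \<Rightarrow> ('a::euclidean_space \<Rightarrow> complex) \<Rightarrow> bool" where
  "C_k 0 f \<longleftrightarrow> continuous_on UNIV f"
| "C_k (Suc k) f \<longleftrightarrow> continuous_on UNIV f \<and>
     (\<forall>b\<in>Basis. (\<forall>x. (\<lambda>h::real. f (x + h *\<^sub>R b)) differentiable (at 0)) \<and>
        C_k k (partial_derivative b f))"

definition test_functions :: "('a::euclidean_space \<Rightarrow> complex) set" where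
  "test_functions = {f. (\<forall>k. C_k k f) \<and> compact (closure {x. f x \<noteq> 0})}"

definition fourier :: "('a::euclidean_space \<Rightarrow> complex) \<Rightarrow> 'a \<Rightarrow> complex" where
  "fourier f \<xi> =
     (LINT x|lborel. f x * exp (- 2 * complex_of_real pi * \<i> * complex_of_real (x \<bullet> \<xi>)))"

definition admissible ::
    "real \<Rightarrow> nat \<Rightarrow> ('a::euclidean_space \<times> 'a \<Rightarrow> complex) \<Rightarrow> bool" where
  "admissible a k m \<longleftrightarrow>
     bounded (range m) \<and> C_k k m \<and> a > real DIM('a) / 2 \<and>
     (\<forall>bs. set bs \<subseteq> Basis \<and> length bs \<le> k \<longrightarrow>
        (\<exists>C. \<forall>\<xi> \<eta>. cmod (iterated_partial bs m (\<xi>, \<eta>))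
                      \<le> C * (1 + norm \<xi> + norm \<eta>) powr (- a)))"

definition bilinear_operator ::
    "('a::euclidean_space \<times> 'a \<Rightarrow> complex) \<Rightarrow> ('a \<Rightarrow> complex) \<Rightarrow> ('a \<Rightarrow> complex) \<Rightarrow> 'a \<Rightarrow> complex"
  where
  "bilinear_operator m f g x =
     (LINT (\<xi>, \<eta>)|lborel. fourier f \<xi> * fourier g \<eta> * m (\<xi>, \<eta>) *
        exp (2 * complex_of_real pi * \<i> * complex_of_real (x \<bullet> (\<xi> + \<eta>))))"

definition dilate ::
    "real \<Rightarrow> real \<Rightarrow> ('a::euclidean_space \<times> 'a \<Rightarrow> complex) \<Rightarrow> 'a \<times> 'a \<Rightarrow> complex" where
  "dilate t\<^sub>1 t\<^sub>2 m = (\<lambda>(\<xi>, \<eta>). m (t\<^sub>1 *\<^sub>R \<xi>, t\<^sub>2 *\<^sub>R \<eta>))"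

definition biparameter_maximal ::
    "('a::euclidean_space \<times> 'a \<Rightarrow> complex) \<Rightarrow> real set \<Rightarrow> real set \<Rightarrow>
     ('a \<Rightarrow> complex) \<Rightarrow> ('a \<Rightarrow> complex) \<Rightarrow> 'a \<Rightarrow> ennreal" where
  "biparameter_maximal m E\<^sub>1 E\<^sub>2 f g x =
     (SUP (t\<^sub>1, t\<^sub>2) \<in> E\<^sub>1 \<times> E\<^sub>2. ennreal (cmod (bilinear_operator (dilate t\<^sub>1 t\<^sub>2 m) f g x)))"

text \<open>The integral is a lower integral for non-measurable \<open>F\<close>; it is only applied
  below to suprema of continuous functions and to continuous functions.\<close>

definition L2_enorm :: "('a::euclidean_space \<Rightarrow> ennreal) \<Rightarrow> ennreal" where
  "L2_enorm F = (let I = (\<integral>\<^sup>+x. (F x)\<^sup>2 \<partial>lborel) in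
     if I = \<infinity> then \<infinity> else ennreal (sqrt (enn2real I)))"

definition sobolev_neg_norm :: "real \<Rightarrow> ('a::euclidean_space \<Rightarrow> complex) \<Rightarrow> ennreal" where
  "sobolev_neg_norm s f =
     L2_enorm (\<lambda>\<xi>. ennreal ((1 + (norm \<xi>)\<^sup>2) powr (- s / 2) * cmod (fourier f \<xi>)))"

text \<open>Meaningful for bounded \<open>E\<close> and \<open>\<delta> > 0\<close>, where finite covers exist; \<open>A\<close> is the
  set of left endpoints of the covering intervals.\<close>

definition covering_number :: "real set \<Rightarrow> real \<Rightarrow> nat" where
  "covering_number E \<delta> =
     (LEAST n. \<exists>A. finite A \<and> card A = n \<and> E \<subseteq> (\<Union>c\<in>A. {c..c + \<delta>}))"

definition upper_minkowski_dim :: "real set \<Rightarrow> ereal" where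
  "upper_minkowski_dim E =
     Limsup (at_right 0) (\<lambda>\<delta>. ereal (ln (real (covering_number E \<delta>)) / ln (1 / \<delta>)))"

end

theory Submission
  imports Defs "HOL-Probability.Probability"
begin

text \<open>
  Split the frequency space of \<open>(\<xi>, \<eta>)\<close> into dyadic shells \<open>|\<xi>| + |\<eta>| \<approx> 2^j\<close>. On the \<open>j\<close>-th shell
  the multiplier has size \<open>2^(-a j)\<close>, and a Plancherel argument bounds the \<open>L\<^sup>2\<close> norm of a single
  operator by \<open>2^(-a j + d j / 2)\<close> times the local \<open>L\<^sup>2\<close> norms of the two Fourier transforms, that is, by
  \<open>2^(- (a - d / 2 - s\<^sub>1 - s\<^sub>2) j)\<close> times the Sobolev norms. If \<open>t\<^sub>1\<close> and \<open>t\<^sub>2\<close> vary in intervals of length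
  \<open>2^(-j)\<close>, the fundamental theorem of calculus in both parameters controls the supremum by the same
  quantity, because a derivative in \<open>t\<^sub>i\<close> costs a factor \<open>2^j\<close>; the mixed derivative is the reason for
  admissibility up to order 2. Up to \<open>2^(\<epsilon> j)\<close>, about \<open>2^((\<beta>\<^sub>1 + \<beta>\<^sub>2) j)\<close> pairs of such intervals cover
  \<open>E\<^sub>1 \<times> E\<^sub>2\<close>, and summing squares over them loses \<open>2^((\<beta>\<^sub>1 + \<beta>\<^sub>2) j / 2)\<close>. By hypothesis the resulting
  series over \<open>j\<close> is geometric.
\<close>

section \<open>Gaussian regularisation\<close>

text \<open>The factor 2^(d j / 2) is geometric. The operator collects all (\<xi>, \<eta>) with the
  same output frequency \<xi> + \<eta>; inside a shell such a fibre has volume of order 2^(d j), and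
  Cauchy-Schwarz along it, followed by Plancherel in x, gives the bound for a single operator. Here
  the restriction to a fibre appears as a Gaussian approximate identity in the difference of two
  output frequencies. The bounds do not depend on its width, so Fatou's lemma removes it.

  The supremum runs over possibly uncountable sets about which only covering numbers are known. All
  estimates are therefore routed through measurable majorants of the squared operator that do not
  depend on the dilation parameters; the sums over coverings and over shells are taken on these
  majorants. Intervals longer than 2^(-j) would make the derivative terms dominate, shorter ones
  would only increase their number. The square of the sum over j is turned into a sum of squares
  pointwise in x, by a weighted Cauchy-Schwarz inequality that spends half of the exponential
  gain.\<close>

definition wave :: "real \<Rightarrow> complex" where
  "wave y = exp (2 * complex_of_real pi * \<i> * complex_of_real y)"

lemma wave_eq_cis: "wave y = cis (2 * pi * y)"
  by (simp add: wave_def cis_conv_exp mult_ac)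

lemma norm_wave [simp]: "norm (wave y) = 1"
  by (simp add: wave_eq_cis)

lemma cnj_wave: "cnj (wave y) = wave (- y)"
  by (simp add: wave_eq_cis cis_cnj)

lemma wave_add: "wave (x + y) = wave x * wave y"
  by (simp add: wave_eq_cis cis_mult distrib_left)

lemma wave_sum: "finite A \<Longrightarrow> wave (\<Sum>i\<in>A. f i) = (\<Prod>i\<in>A. wave (f i))"
  by (induction A rule: finite_induct) (simp_all add: wave_add, simp add: wave_def)

lemma continuous_on_wave [continuous_intros]:
  "continuous_on S f \<Longrightarrow> continuous_on S (\<lambda>x. wave (f x))"
  unfolding wave_def by (intro continuous_intros)

lemma borel_measurable_wave [measurable]: "wave \<in> borel_measurable borel"
  by (intro borel_measurable_continuous_onI continuous_intros)

lemma borel_measurable_cnj [measurable]: "cnj \<in> borel_measurable borel"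
  by (intro borel_measurable_continuous_onI continuous_intros)

text \<open>The substitution s * x reduces both claims to the characteristic function of the
  standard normal law at u = 2 pi v / s. The 2 pi in the width s / (2 pi) comes from the
  normalisation of \<open>wave\<close>. A small s means a nearly constant weight and a sharply
  concentrated density.\<close>

lemma gaussian_wave_1d:
  assumes s: "s > 0"
  shows "integrable lborel (\<lambda>x. complex_of_real (exp (- (s * x)\<^sup>2 / 2)) * wave (x * v))"
    and "(LINT x|lborel. complex_of_real (exp (- (s * x)\<^sup>2 / 2)) * wave (x * v)) =
      complex_of_real (normal_density 0 (s / (2 * pi)) v)"
proof -
  define u where "u = 2 * pi * v / s"
  let ?n = "\<lambda>x. complex_of_real (std_normal_density x) * exp (\<i> * complex_of_real (u * x))"
  have conv: "complex_of_real (exp (- (s * x)\<^sup>2 / 2)) * wave (x * v) =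
      complex_of_real (sqrt (2 * pi)) * ?n (0 + s * x)" for x
  proof -
    have "wave (x * v) = exp (\<i> * complex_of_real (u * (s * x)))"
      using s by (simp add: wave_def u_def mult_ac)
    then show ?thesis by (simp add: std_normal_density_def mult_ac)
  qed
  have n_int: "integrable lborel ?n"
    by (rule Bochner_Integration.integrable_bound[OF integrable_normal_density[of 1 0]])
      (auto simp: norm_mult)
  then show "integrable lborel (\<lambda>x. complex_of_real (exp (- (s * x)\<^sup>2 / 2)) * wave (x * v))"
    unfolding conv using s by (intro integrable_mult_right lborel_integrable_real_affine) auto
  have "exp (- u\<^sup>2 / 2) = (LINT x|lborel. ?n x)"
  proof -
    have "complex_of_real (exp (- u\<^sup>2 / 2)) = char std_normal_distribution u"
      by (simp add: char_std_normal_distribution)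
    also have "\<dots> = (LINT x|lborel. std_normal_density x *\<^sub>R iexp (u * x))"
      unfolding char_def by (subst integral_density) auto
    finally show ?thesis by (simp add: scaleR_conv_of_real)
  qed
  also have "\<dots> = s *\<^sub>R (LINT x|lborel. ?n (0 + s * x))"
    using s by (subst lborel_integral_real_affine[of s _ 0]) auto
  finally have "(LINT x|lborel. ?n (0 + s * x)) = exp (- u\<^sup>2 / 2) / s"
    using s by (simp add: scaleR_conv_of_real field_simps)
  then have "(LINT x|lborel. complex_of_real (exp (- (s * x)\<^sup>2 / 2)) * wave (x * v))
      = complex_of_real (sqrt (2 * pi) * (exp (- u\<^sup>2 / 2) / s))"
    unfolding conv integral_mult_right_zero by simp
  also have "sqrt (2 * pi) * (exp (- u\<^sup>2 / 2) / s) = normal_density 0 (s / (2 * pi)) v"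
  proof -
    have "sqrt (2 * pi * (s / (2 * pi))\<^sup>2) = s / sqrt (2 * pi)"
      using s by (simp add: real_sqrt_mult real_sqrt_divide power_divide field_simps
          flip: power2_eq_square)
    moreover have "v\<^sup>2 / (2 * (s / (2 * pi))\<^sup>2) = u\<^sup>2 / 2"
      using s by (simp add: u_def field_simps power2_eq_square)
    ultimately show ?thesis by (simp add: normal_density_def)
  qed
  finally show "(LINT x|lborel. complex_of_real (exp (- (s * x)\<^sup>2 / 2)) * wave (x * v)) =
      complex_of_real (normal_density 0 (s / (2 * pi)) v)" .
qed

text \<open>This is exp(- s^2 |x|^2 / 2), written as a product over coordinates so that the
  one-dimensional transform extends by Fubini over the product measure.\<close>

definition gauss_weight :: "real \<Rightarrow> 'a::euclidean_space \<Rightarrow> real" where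
  "gauss_weight s x = (\<Prod>b\<in>Basis. exp (- (s * (x \<bullet> b))\<^sup>2 / 2))"

definition gauss_kernel :: "real \<Rightarrow> 'a::euclidean_space \<Rightarrow> real" where
  "gauss_kernel s v = (\<Prod>b\<in>Basis. normal_density 0 (s / (2 * pi)) (v \<bullet> b))"

lemma gauss_weight_nonneg [simp]: "gauss_weight s x \<ge> 0"
  by (simp add: gauss_weight_def prod_nonneg)

lemma gauss_kernel_nonneg [simp]: "gauss_kernel s x \<ge> 0"
  by (simp add: gauss_kernel_def prod_nonneg)

lemma borel_measurable_gauss_weight [measurable]: "gauss_weight s \<in> borel_measurable borel"
  unfolding gauss_weight_def by measurable

lemma borel_measurable_gauss_kernel [measurable]: "gauss_kernel s \<in> borel_measurable borel"
  unfolding gauss_kernel_def by measurable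

lemma gauss_kernel_minus: "gauss_kernel s (- v) = gauss_kernel s v"
  by (simp add: gauss_kernel_def normal_density_def)

lemma gaussian_wave:
  fixes v :: "'a::euclidean_space"
  assumes s: "s > 0"
  shows "integrable lborel (\<lambda>x. complex_of_real (gauss_weight s x) * wave (x \<bullet> v))" (is ?int)
    and "(LINT x|lborel. complex_of_real (gauss_weight s x) * wave (x \<bullet> v)) =
      complex_of_real (gauss_kernel s v)" (is ?eq)
proof -
  interpret product_sigma_finite "\<lambda>_::'a. lborel :: real measure"
    by standard
  let ?f = "\<lambda>b x. complex_of_real (exp (- (s * x)\<^sup>2 / 2)) * wave (x * (v \<bullet> b))"
  have eq: "complex_of_real (gauss_weight s x) * wave (x \<bullet> v) = (\<Prod>b\<in>Basis. ?f b (x \<bullet> b))" for x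
    by (simp add: gauss_weight_def euclidean_inner[of x v] wave_sum prod.distrib)
  have coord: "(\<Prod>b\<in>Basis. ?f b ((\<Sum>b\<in>Basis. x b *\<^sub>R b) \<bullet> b)) = (\<Prod>b\<in>Basis. ?f b (x b))"
    for x :: "'a \<Rightarrow> real"
    by (intro prod.cong refl) simp
  have int: "integrable (Pi\<^sub>M Basis (\<lambda>_. lborel)) (\<lambda>x. \<Prod>b\<in>(Basis::'a set). ?f b (x b))"
    using gaussian_wave_1d[OF s] by (intro product_integrable_prod) auto
  show ?int
    unfolding eq by (subst lborel_eq, subst integrable_distr_eq) (use int in \<open>simp_all add: coord\<close>)
  have "(LINT x|Pi\<^sub>M Basis (\<lambda>_. lborel). (\<Prod>b\<in>(Basis::'a set). ?f b (x b))) =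
      complex_of_real (gauss_kernel s v)"
    using gaussian_wave_1d[OF s] by (subst product_integral_prod) (auto simp: gauss_kernel_def)
  then show ?eq
    unfolding eq by (subst lborel_eq, subst integral_distr) (simp_all add: coord)
qed

lemma integrable_gauss_weight:
  assumes "s > 0"
  shows "integrable lborel (gauss_weight s :: 'a::euclidean_space \<Rightarrow> real)"
proof -
  have "integrable lborel (\<lambda>x::'a. norm (complex_of_real (gauss_weight s x) * wave (x \<bullet> 0)))"
    by (intro integrable_norm gaussian_wave assms)
  then show ?thesis by (simp add: norm_mult)
qed

lemma nn_integral_gauss_kernel:
  assumes "s > 0"
  shows "(\<integral>\<^sup>+v. gauss_kernel s (v :: 'a::euclidean_space) \<partial>lborel) = 1"
proof -
  have "(\<integral>\<^sup>+v. gauss_kernel s (v :: 'a) \<partial>lborel) =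
      (\<integral>\<^sup>+v. (\<Prod>b\<in>Basis. ennreal (normal_density 0 (s / (2 * pi)) (v \<bullet> b))) \<partial>(lborel :: 'a measure))"
    by (simp add: gauss_kernel_def prod_ennreal)
  also have "\<dots> = (\<Prod>b\<in>(Basis::'a set). \<integral>\<^sup>+v. ennreal (normal_density 0 (s / (2 * pi)) v) \<partial>lborel)"
    by (subst nn_integral_lborel_prod) auto
  also have "(\<integral>\<^sup>+v. ennreal (normal_density 0 (s / (2 * pi)) v) \<partial>lborel) = 1"
    using assms by (subst nn_integral_eq_integral) auto
  finally show ?thesis by simp
qed

lemma nn_integral_gauss_kernel_diff:
  fixes c :: "'a::euclidean_space"
  assumes "s > 0"
  shows "(\<integral>\<^sup>+v. gauss_kernel s (c - v) \<partial>lborel) = 1"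
proof -
  have "(\<integral>\<^sup>+v. gauss_kernel s (c - v) \<partial>lborel) = (\<integral>\<^sup>+v. gauss_kernel s ((-c) + v) \<partial>lborel)"
    by (subst gauss_kernel_minus[symmetric]) (simp add: add.commute)
  also have "\<dots> = (\<integral>\<^sup>+v. gauss_kernel s v \<partial>distr lborel borel ((+) (-c)))"
    by (subst nn_integral_distr) auto
  finally show ?thesis
    by (simp add: lborel_distr_plus nn_integral_gauss_kernel assms)
qed

text \<open>Without integrability the Bochner integral is 0 by convention, so the bound is
  unconditional.\<close>

lemma norm_integral_le_nn_integral:
  fixes f :: "'b \<Rightarrow> 'c::{banach, second_countable_topology}"
  shows "ennreal (norm (integral\<^sup>L M f)) \<le> (\<integral>\<^sup>+x. ennreal (norm (f x)) \<partial>M)"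
proof (cases "integrable M f")
  case True
  then show ?thesis by (rule integral_norm_bound_ennreal)
qed (simp add: not_integrable_integral_eq)

text \<open>Integrating against a Gaussian, whose Fourier transform is a probability density, makes
  Fubini's theorem applicable. This one-sided form of Plancherel's theorem avoids Fourier
  inversion.\<close>

lemma weighted_L2_bound:
  fixes H :: "'b::euclidean_space \<Rightarrow> complex" and \<sigma> :: "'b \<Rightarrow> 'a::euclidean_space"
  assumes s: "s > 0" and H: "integrable lborel H" and \<sigma> [measurable]: "\<sigma> \<in> borel_measurable borel"
  shows "(\<integral>\<^sup>+x. ennreal ((cmod (LINT z|lborel. H z * wave (x \<bullet> \<sigma> z)))\<^sup>2 * gauss_weight s x) \<partial>lborel)
    \<le> (\<integral>\<^sup>+z. \<integral>\<^sup>+z'. ennreal (cmod (H z) * cmod (H z') * gauss_kernel s (\<sigma> z - \<sigma> z')) \<partial>lborel \<partial>lborel)"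
proof -
  have Hm [measurable]: "H \<in> borel_measurable borel" using H by auto
  let ?K = "\<lambda>x. LINT z|lborel. H z * wave (x \<bullet> \<sigma> z)"
  let ?L = "lborel :: 'b measure"
  let ?N = "?L \<Otimes>\<^sub>M ?L"
  define J where "J = (\<lambda>p. H (fst p) * cnj (H (snd p)))"
  define d where "d = (\<lambda>p. \<sigma> (fst p) - \<sigma> (snd p))"
  have Jm [measurable]: "J \<in> borel_measurable ?N" unfolding J_def by measurable
  have dm [measurable]: "d \<in> borel_measurable ?N" unfolding d_def by measurable
  have Hw: "integrable lborel (\<lambda>z. H z * wave (x \<bullet> \<sigma> z))" for x
    by (rule Bochner_Integration.integrable_bound[OF H]) (auto simp: norm_mult)
  have HH: "integrable ?N (\<lambda>p. F (fst p) * G (snd p))"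
    if "integrable lborel F" "integrable lborel G" for F G :: "'b \<Rightarrow> complex"
  proof -
    have [measurable]: "F \<in> borel_measurable borel" "G \<in> borel_measurable borel"
      using that by auto
    show ?thesis
    proof (rule lborel_pair.Fubini_integrable)
      have "integrable lborel (\<lambda>x. norm (F x) * (LINT y|lborel. norm (G y)))"
        by (intro integrable_mult_left integrable_norm that)
      then show "integrable lborel (\<lambda>x. LINT y|?L. norm (F (fst (x, y)) * G (snd (x, y))))"
        by (simp add: norm_mult)
    qed (use that in auto)
  qed
  have J: "integrable ?N J"
    unfolding J_def by (intro HH H integrable_cnj)
  have sq: "complex_of_real ((cmod (?K x))\<^sup>2) = (LINT p|?N. J p * wave (x \<bullet> d p))" for x
  proof -
    have cK: "cnj (?K x) = (LINT z|lborel. cnj (H z * wave (x \<bullet> \<sigma> z)))"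
      by (rule Bochner_Integration.integral_cnj[symmetric])
    have int: "integrable ?N (\<lambda>p. (H (fst p) * wave (x \<bullet> \<sigma> (fst p))) * cnj (H (snd p) * wave (x \<bullet> \<sigma> (snd p))))"
      by (intro HH Hw integrable_cnj)
    have "complex_of_real ((cmod (?K x))\<^sup>2) = ?K x * cnj (?K x)"
      by (rule complex_norm_square)
    also have "\<dots> = (LINT z|?L. (LINT z'|?L. (H z * wave (x \<bullet> \<sigma> z)) * cnj (H z' * wave (x \<bullet> \<sigma> z'))))"
      unfolding cK integral_mult_right_zero integral_mult_left_zero ..
    also have "\<dots> = (LINT p|?N. (H (fst p) * wave (x \<bullet> \<sigma> (fst p))) * cnj (H (snd p) * wave (x \<bullet> \<sigma> (snd p))))"
      using lborel_pair.integral_fst'[OF int] by simp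
    also have "\<dots> = (LINT p|?N. J p * wave (x \<bullet> d p))"
      by (intro Bochner_Integration.integral_cong refl)
        (simp add: J_def d_def cnj_wave inner_diff_right wave_add[of _ "- y" for y, simplified] mult_ac)
    finally show ?thesis .
  qed
  interpret pair_sigma_finite "lborel :: 'a measure" ?N
    by (simp add: lborel_prod pair_sigma_finite_def sigma_finite_lborel)
  let ?g = "\<lambda>x p. J p * (complex_of_real (gauss_weight s x) * wave (x \<bullet> d p))"
  have g: "integrable (lborel \<Otimes>\<^sub>M ?N) (case_prod ?g)"
  proof (rule Fubini_integrable)
    have "integrable lborel (\<lambda>x::'a. gauss_weight s x * (LINT p|?N. norm (J p)))"
      by (intro integrable_mult_left integrable_gauss_weight s)
    then show "integrable lborel (\<lambda>x::'a. LINT p|?N. norm (case_prod ?g (x, p)))"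
      by (simp add: norm_mult mult.commute)
    show "AE x in lborel. integrable ?N (\<lambda>p. case_prod ?g (x, p))"
    proof (rule AE_I2)
      fix x :: 'a
      show "integrable ?N (\<lambda>p. case_prod ?g (x, p))"
        by (rule Bochner_Integration.integrable_bound[OF integrable_mult_left[OF J, of "complex_of_real (gauss_weight s x)"]])
          (auto simp: norm_mult)
    qed
  qed measurable
  let ?w = "\<lambda>x. (cmod (?K x))\<^sup>2 * gauss_weight s x"
  have w_eq: "complex_of_real (?w x) = (LINT p|?N. ?g x p)" for x
  proof -
    have "complex_of_real (?w x) = (LINT p|?N. J p * wave (x \<bullet> d p)) * complex_of_real (gauss_weight s x)"
      by (simp add: sq[symmetric])
    then show ?thesis
      unfolding integral_mult_left_zero[symmetric] by (simp add: mult_ac)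
  qed
  have w_int: "integrable lborel (\<lambda>x. complex_of_real (?w x))"
    unfolding w_eq using integrable_fst[OF g] by simp
  have "complex_of_real (LINT x|lborel. ?w x) = (LINT x|lborel. complex_of_real (?w x))"
    by (rule integral_complex_of_real[symmetric])
  also have "\<dots> = (LINT x|lborel. LINT p|?N. ?g x p)"
    by (simp only: w_eq)
  also have "\<dots> = (LINT p|?N. LINT x|lborel. ?g x p)"
    by (rule Fubini_integral[OF g, symmetric])
  also have "\<dots> = (LINT p|?N. J p * complex_of_real (gauss_kernel s (d p)))"
    by (simp add: gaussian_wave(2)[OF s])
  finally have main: "complex_of_real (LINT x|lborel. ?w x) = (LINT p|?N. J p * complex_of_real (gauss_kernel s (d p)))" .
  have "(\<integral>\<^sup>+x. ennreal (?w x) \<partial>lborel) = ennreal (LINT x|lborel. ?w x)"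
    using w_int by (intro nn_integral_eq_integral) (auto simp only: complex_of_real_integrable_eq, simp)
  \<comment> \<open>Absolute values enter only here, after the x-integral has replaced the
    oscillation by the positive kernel. Taken earlier, they would have destroyed all localisation to
    equal values of \<open>\<sigma>\<close>.\<close>
  also have "(LINT x|lborel. ?w x) \<le> cmod (LINT p|?N. J p * complex_of_real (gauss_kernel s (d p)))"
    unfolding main[symmetric] norm_of_real by simp
  also have "ennreal \<dots> \<le> (\<integral>\<^sup>+p. ennreal (cmod (J p * complex_of_real (gauss_kernel s (d p)))) \<partial>?N)"
    by (rule norm_integral_le_nn_integral)
  also have "\<dots> = (\<integral>\<^sup>+z. \<integral>\<^sup>+z'. ennreal (cmod (J (z, z') * complex_of_real (gauss_kernel s (d (z, z'))))) \<partial>lborel \<partial>lborel)"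
    by (rule lborel.nn_integral_fst[symmetric]) measurable
  finally show ?thesis by (simp add: J_def d_def norm_mult ennreal_leI)
qed

section \<open>Frequency-localised bilinear operators\<close>

lemma borel_measurable_fst: "(fst :: 'a::euclidean_space \<times> 'b::euclidean_space \<Rightarrow> 'a) \<in> borel_measurable borel"
  and borel_measurable_snd: "(snd :: 'a \<times> 'b \<Rightarrow> 'b) \<in> borel_measurable borel"
  by (intro borel_measurable_continuous_onI continuous_intros)+

definition local_energy :: "('a::euclidean_space \<Rightarrow> complex) \<Rightarrow> real \<Rightarrow> ennreal" where
  "local_energy F M = (\<integral>\<^sup>+\<xi>. ennreal ((cmod (F \<xi>))\<^sup>2) * indicator (cball 0 M) \<xi> \<partial>lborel)"

lemma nn_integral_lborel_pair:
  fixes f :: "'a::euclidean_space \<Rightarrow> 'b::euclidean_space \<Rightarrow> ennreal"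
  assumes [measurable]: "(\<lambda>z. f (fst z) (snd z)) \<in> borel_measurable borel"
  shows "(\<integral>\<^sup>+z. f (fst z) (snd z) \<partial>lborel) = (\<integral>\<^sup>+x. \<integral>\<^sup>+y. f x y \<partial>lborel \<partial>lborel)"
proof -
  have "(\<lambda>z. f (fst z) (snd z)) \<in> borel_measurable (lborel \<Otimes>\<^sub>M lborel)"
    using assms by (simp add: lborel_prod)
  from lborel.nn_integral_fst[OF this] show ?thesis by (simp add: lborel_prod)
qed

text \<open>The multiplier \<open>n\<close> is arbitrary because the same operator is also formed
  with the parameter derivatives of the dilated multiplier. The cut-off is a separate argument, so
  that it stays fixed while \<open>n\<close> varies.\<close>

definition localized_bilinear ::
    "('a::euclidean_space \<times> 'a) set \<Rightarrow> ('a \<Rightarrow> complex) \<Rightarrow> ('a \<Rightarrow> complex) \<Rightarrow> ('a \<times> 'a \<Rightarrow> complex) \<Rightarrow> 'a \<Rightarrow> complex"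
  where "localized_bilinear A F G n x =
    (LINT z|lborel. (indicator A z * (F (fst z) * G (snd z)) * n z) * wave (x \<bullet> (fst z + snd z)))"

lemma borel_measurable_localized_bilinear:
  assumes [measurable]: "F \<in> borel_measurable borel" "G \<in> borel_measurable borel" "A \<in> sets borel"
    "(\<lambda>(u, z). n u z) \<in> borel_measurable (N \<Otimes>\<^sub>M borel)" "h \<in> borel_measurable N"
  shows "(\<lambda>u. localized_bilinear A F G (n u) (h u)) \<in> borel_measurable N"
proof -
  have [measurable]: "(\<lambda>p. n (fst p) (snd p)) \<in> borel_measurable (N \<Otimes>\<^sub>M lborel)"
    using assms(4) by (simp add: case_prod_beta' cong: measurable_cong_sets)
  note [measurable] = borel_measurable_fst borel_measurable_snd
  show ?thesis
    unfolding localized_bilinear_def by measurable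
qed

text \<open>A bounded function on a bounded set. The sup bounds \<open>CF\<close> and
  \<open>CG\<close> serve integrability alone; the later estimates are in terms of local energies,
  which keeps their constants independent of f and g.\<close>

lemma integrable_localized:
  fixes F G :: "'a::euclidean_space \<Rightarrow> complex"
  assumes [measurable]: "F \<in> borel_measurable borel" "G \<in> borel_measurable borel"
      "n \<in> borel_measurable borel" "A \<in> sets borel"
    and A: "A \<subseteq> cball 0 M \<times> cball 0 M"
    and F: "\<And>\<xi>. cmod (F \<xi>) \<le> CF" and G: "\<And>\<eta>. cmod (G \<eta>) \<le> CG"
    and n: "\<And>z. z \<in> A \<Longrightarrow> cmod (n z) \<le> B"
  shows "integrable lborel (\<lambda>z. indicator A z * (F (fst z) * G (snd z)) * n z)"
proof (rule Bochner_Integration.integrable_bound)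
  note [measurable] = borel_measurable_fst borel_measurable_snd
  show "(\<lambda>z. indicator A z * (F (fst z) * G (snd z)) * n z) \<in> borel_measurable lborel"
    by measurable
  have "bounded A" using A bounded_Times[OF bounded_cball bounded_cball] bounded_subset by blast
  then show "integrable lborel (\<lambda>z. indicator A z *\<^sub>R (CF * CG * B))"
    using emeasure_bounded_finite[of A] by (intro integrable_scaleR_left) (auto simp: integrable_indicator_iff)
  have "0 \<le> CF" "0 \<le> CG"
    using order.trans[OF norm_ge_zero F] order.trans[OF norm_ge_zero G] by auto
  then have "cmod (F (fst z)) * cmod (G (snd z)) * cmod (n z) \<le> \<bar>CF * CG * B\<bar>" if "z \<in> A" for z
    using F[of "fst z"] G[of "snd z"] n[OF that]
    by (intro order.trans[OF mult_mono[OF mult_mono] abs_ge_self])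
      auto
  then show "AE z in lborel. cmod (indicator A z * (F (fst z) * G (snd z)) * n z)
      \<le> norm (indicator A z *\<^sub>R (CF * CG * B))"
    by (auto simp: norm_mult indicator_def)
qed

text \<open>With \<open>\<sigma>\<close> the output frequency, the kernel couples only those pairs
  of points whose output frequencies nearly agree. Since it has total mass 1 for every s, the bound
  is uniform in s. The factor 2 accounts for the two symmetric terms of the AM-GM step.\<close>

lemma localized_bilinear_weighted_L2:
  fixes F G :: "'a::euclidean_space \<Rightarrow> complex"
  assumes s: "s > 0"
    and meas [measurable]: "F \<in> borel_measurable borel" "G \<in> borel_measurable borel"
      "n \<in> borel_measurable borel" "A \<in> sets borel"
    and A: "A \<subseteq> cball 0 M \<times> cball 0 M"
    and F: "\<And>\<xi>. cmod (F \<xi>) \<le> CF" and G: "\<And>\<eta>. cmod (G \<eta>) \<le> CG"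
    and n: "\<And>z. z \<in> A \<Longrightarrow> cmod (n z) \<le> B"
  shows "(\<integral>\<^sup>+x. ennreal ((cmod (localized_bilinear A F G n x))\<^sup>2 * gauss_weight s x) \<partial>lborel)
    \<le> 2 * (ennreal (B\<^sup>2) * (emeasure lborel (cball 0 M :: 'a set) * local_energy F M * local_energy G M))"
proof -
  define H where "H = (\<lambda>z. indicator A z * (F (fst z) * G (snd z)) * n z)"
  define \<sigma> where "\<sigma> = (\<lambda>z::'a \<times> 'a. fst z + snd z)"
  define p where "p = (\<lambda>\<xi>. ennreal ((cmod (F \<xi>))\<^sup>2) * indicator (cball 0 M) \<xi>)"
  define q where "q = (\<lambda>\<xi>. ennreal ((cmod (G \<xi>))\<^sup>2) * indicator (cball 0 M) \<xi>)"
  \<comment> \<open>Of the four frequency variables, \<open>fst z'\<close> and \<open>snd z\<close>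
    carry the energies of F and G. The variable \<open>snd z'\<close> occurs only in the kernel and
    integrates to 1; \<open>fst z\<close> is then left without any density and costs the volume of
    the ball, which is the source of the power of 2 with exponent d j.\<close>
  define T where "T = (\<lambda>z z'. ennreal (B\<^sup>2) * (indicator (cball 0 M) (fst z) * q (snd z) *
      (p (fst z') * ennreal (gauss_kernel s (\<sigma> z - \<sigma> z')))))"
  note [measurable] = borel_measurable_fst borel_measurable_snd
  have [measurable]: "(cball 0 M :: 'a set) \<in> sets borel"
    by simp
  have [measurable]: "p \<in> borel_measurable borel" "q \<in> borel_measurable borel"
      "\<sigma> \<in> borel_measurable borel"
    unfolding p_def q_def \<sigma>_def by measurable
  have Hint: "integrable lborel H"
    unfolding H_def by (rule integrable_localized[OF meas A F G n])
  have int1: "(\<integral>\<^sup>+z'. T z z' \<partial>lborel)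
      = ennreal (B\<^sup>2) * (local_energy F M * (indicator (cball 0 M) (fst z) * q (snd z)))" for z
  proof -
    have "(\<integral>\<^sup>+z'. p (fst z') * ennreal (gauss_kernel s (\<sigma> z - \<sigma> z')) \<partial>lborel)
        = (\<integral>\<^sup>+\<xi>. \<integral>\<^sup>+\<eta>. p \<xi> * ennreal (gauss_kernel s (\<sigma> z - (\<xi> + \<eta>))) \<partial>lborel \<partial>lborel)"
      unfolding \<sigma>_def by (rule nn_integral_lborel_pair) measurable
    also have "\<dots> = (\<integral>\<^sup>+\<xi>. p \<xi> * (\<integral>\<^sup>+\<eta>. ennreal (gauss_kernel s ((\<sigma> z - \<xi>) - \<eta>)) \<partial>lborel) \<partial>lborel)"
      by (intro nn_integral_cong) (simp add: nn_integral_cmult diff_diff_eq)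
    also have "\<dots> = local_energy F M"
      by (simp add: nn_integral_gauss_kernel_diff[OF s] local_energy_def p_def)
    finally show ?thesis
      unfolding T_def by (simp add: nn_integral_cmult) (simp add: mult_ac)
  qed
  have int2: "(\<integral>\<^sup>+z. \<integral>\<^sup>+z'. T z z' \<partial>lborel \<partial>lborel)
      = ennreal (B\<^sup>2) * (emeasure lborel (cball 0 M :: 'a set) * local_energy F M * local_energy G M)"
  proof -
    have "(\<integral>\<^sup>+z. indicator (cball 0 M) (fst z :: 'a) * q (snd z) \<partial>lborel)
        = (\<integral>\<^sup>+\<xi>. \<integral>\<^sup>+\<eta>. indicator (cball 0 M) (\<xi> :: 'a) * q \<eta> \<partial>lborel \<partial>lborel)"
      by (rule nn_integral_lborel_pair[where f = "\<lambda>\<xi> \<eta>. indicator (cball 0 M) \<xi> * q \<eta>"]) measurable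
    also have "\<dots> = local_energy G M * emeasure lborel (cball 0 M :: 'a set)"
      by (simp add: nn_integral_cmult nn_integral_multc local_energy_def q_def mult.commute)
    finally show ?thesis
      unfolding int1 by (simp add: nn_integral_cmult) (simp add: mult_ac)
  qed
  have [measurable]: "case_prod T \<in> borel_measurable (lborel \<Otimes>\<^sub>M lborel)"
    unfolding T_def by measurable
  have pt: "ennreal (cmod (H z) * cmod (H z') * gauss_kernel s (\<sigma> z - \<sigma> z')) \<le> T z z' + T z' z" for z z'
  proof (cases "z \<in> A \<and> z' \<in> A")
    case False
    then show ?thesis by (auto simp: H_def)
  next
    case True
    with A have ball: "fst z \<in> cball 0 M" "snd z \<in> cball 0 M" "fst z' \<in> cball 0 M" "snd z' \<in> cball 0 M"
      by auto
    have sym: "gauss_kernel s (\<sigma> z' - \<sigma> z) = gauss_kernel s (\<sigma> z - \<sigma> z')"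
      using gauss_kernel_minus[of s "\<sigma> z - \<sigma> z'"] by simp
    let ?a = "cmod (F (fst z')) * cmod (G (snd z))" and ?b = "cmod (F (fst z)) * cmod (G (snd z'))"
    have "0 \<le> B" using n[of z] True by (auto intro: order.trans[OF norm_ge_zero])
    \<comment> \<open>The factors are paired crosswise, so that AM-GM leaves one energy in each of the two points;
      the convolution kernel then integrates to 1 in a free variable.\<close>
    have "cmod (H z) * cmod (H z') = (cmod (n z) * cmod (n z')) * (?a * ?b)"
      using True by (simp add: H_def norm_mult)
    also have "\<dots> \<le> (B * B) * (?a\<^sup>2 + ?b\<^sup>2)"
    proof (rule mult_mono)
      have "0 \<le> (?a - ?b)\<^sup>2" by simp
      moreover have "0 \<le> ?a * ?b" by simp
      ultimately show "?a * ?b \<le> ?a\<^sup>2 + ?b\<^sup>2"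
        unfolding power2_diff by linarith
    qed (use n[of z] n[of z'] True \<open>0 \<le> B\<close> in \<open>simp_all add: mult_mono\<close>)
    finally have "cmod (H z) * cmod (H z') * gauss_kernel s (\<sigma> z - \<sigma> z')
        \<le> (B * B) * (?a\<^sup>2 + ?b\<^sup>2) * gauss_kernel s (\<sigma> z - \<sigma> z')"
      by (rule mult_right_mono) simp
    also have "ennreal \<dots> = ennreal (B\<^sup>2 * (?a\<^sup>2 * gauss_kernel s (\<sigma> z - \<sigma> z')))
        + ennreal (B\<^sup>2 * (?b\<^sup>2 * gauss_kernel s (\<sigma> z - \<sigma> z')))"
      by (subst ennreal_plus[symmetric])
        (simp_all del: ennreal_plus add: algebra_simps flip: power2_eq_square)
    also have "\<dots> = T z z' + T z' z"
      using ball unfolding T_def p_def q_def sym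
      by (simp add: ennreal_mult[symmetric] power_mult_distrib mult_ac)
    finally show ?thesis by (simp add: ennreal_leI)
  qed
  have "(\<integral>\<^sup>+x. ennreal ((cmod (localized_bilinear A F G n x))\<^sup>2 * gauss_weight s x) \<partial>lborel)
      \<le> (\<integral>\<^sup>+z. \<integral>\<^sup>+z'. ennreal (cmod (H z) * cmod (H z') * gauss_kernel s (\<sigma> z - \<sigma> z')) \<partial>lborel \<partial>lborel)"
    using weighted_L2_bound[OF s Hint, of \<sigma>] by (simp add: localized_bilinear_def H_def \<sigma>_def)
  also have "\<dots> \<le> (\<integral>\<^sup>+z. \<integral>\<^sup>+z'. T z z' + T z' z \<partial>lborel \<partial>lborel)"
    by (intro nn_integral_mono pt)
  also have "\<dots> = (\<integral>\<^sup>+z. \<integral>\<^sup>+z'. T z z' \<partial>lborel \<partial>lborel) + (\<integral>\<^sup>+z. \<integral>\<^sup>+z'. T z' z \<partial>lborel \<partial>lborel)"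
    by (simp add: nn_integral_add)
  also have "(\<integral>\<^sup>+z. \<integral>\<^sup>+z'. T z' z \<partial>lborel \<partial>lborel) = (\<integral>\<^sup>+z. \<integral>\<^sup>+z'. T z z' \<partial>lborel \<partial>lborel)"
    by (rule lborel_pair.Fubini') simp
  finally show ?thesis unfolding int2 by (simp add: mult_2)
qed

lemma gauss_weight_tendsto: "(\<lambda>k. gauss_weight (1 / real (Suc k)) x) \<longlonglongrightarrow> 1"
proof -
  have "(\<lambda>k. gauss_weight (1 / real (Suc k)) x) \<longlonglongrightarrow> (\<Prod>b\<in>Basis. exp (- (0 * (x \<bullet> b))\<^sup>2 / 2))"
    unfolding gauss_weight_def
    by (intro tendsto_intros LIMSEQ_inverse_real_of_nat[unfolded inverse_eq_divide])
      (simp_all add: lim_1_over_n LIMSEQ_Suc)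
  then show ?thesis by simp
qed

text \<open>Fatou's lemma along the weights with s = 1 / (k + 1): they tend to 1 pointwise while the
  weighted bound stays the same.\<close>

lemma localized_bilinear_L2:
  fixes F G :: "'a::euclidean_space \<Rightarrow> complex"
  assumes meas [measurable]: "F \<in> borel_measurable borel" "G \<in> borel_measurable borel"
      "n \<in> borel_measurable borel" "A \<in> sets borel"
    and A: "A \<subseteq> cball 0 M \<times> cball 0 M"
    and F: "\<And>\<xi>. cmod (F \<xi>) \<le> CF" and G: "\<And>\<eta>. cmod (G \<eta>) \<le> CG"
    and n: "\<And>z. z \<in> A \<Longrightarrow> cmod (n z) \<le> B"
  shows "(\<integral>\<^sup>+x. ennreal ((cmod (localized_bilinear A F G n x))\<^sup>2) \<partial>lborel)
    \<le> 2 * (ennreal (B\<^sup>2) * (emeasure lborel (cball 0 M :: 'a set) * local_energy F M * local_energy G M))"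
    (is "_ \<le> ?R")
proof -
  have [measurable]: "localized_bilinear A F G n \<in> borel_measurable borel"
    by (rule borel_measurable_localized_bilinear) measurable
  let ?K = "\<lambda>x. (cmod (localized_bilinear A F G n x))\<^sup>2"
  have "(\<integral>\<^sup>+x. ennreal (?K x) \<partial>lborel)
      = (\<integral>\<^sup>+x. liminf (\<lambda>k. ennreal (?K x * gauss_weight (1 / real (Suc k)) x)) \<partial>lborel)"
  proof (intro nn_integral_cong lim_imp_Liminf[symmetric] tendsto_ennrealI)
    fix x :: 'a
    show "(\<lambda>k. ?K x * gauss_weight (1 / real (Suc k)) x) \<longlonglongrightarrow> ?K x"
      using tendsto_mult[OF tendsto_const gauss_weight_tendsto, of "?K x" x] by simp
  qed simp
  also have "\<dots> \<le> liminf (\<lambda>k. \<integral>\<^sup>+x. ennreal (?K x * gauss_weight (1 / real (Suc k)) x) \<partial>lborel)"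
    by (intro nn_integral_liminf) measurable
  also have "\<dots> \<le> liminf (\<lambda>k. ?R)"
    by (intro Liminf_mono always_eventually allI localized_bilinear_weighted_L2[OF _ meas A F G n]) auto
  also have "\<dots> = ?R" by (simp add: Liminf_const)
  finally show ?thesis .
qed

section \<open>Varying the dilation parameters\<close>

lemma partial_derivative_along_line:
  assumes "C_k (Suc k) f" "b \<in> Basis"
  shows "((\<lambda>h. f (x + h *\<^sub>R b)) has_vector_derivative partial_derivative b f (x + h *\<^sub>R b)) (at h within S)"
proof -
  have "(\<lambda>t::real. f ((x + h *\<^sub>R b) + t *\<^sub>R b)) differentiable (at 0)"
    using assms by auto
  then have "((\<lambda>t. f ((x + h *\<^sub>R b) + t *\<^sub>R b)) has_vector_derivative partial_derivative b f (x + h *\<^sub>R b)) (at (h - h))"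
    unfolding partial_derivative_def by (simp add: vector_derivative_works)
  moreover have "((\<lambda>t. t - h) has_vector_derivative 1) (at h)"
    by (auto intro!: derivative_eq_intros)
  ultimately have "(((\<lambda>t. f ((x + h *\<^sub>R b) + t *\<^sub>R b)) \<circ> (\<lambda>t. t - h)) has_vector_derivative
      1 *\<^sub>R partial_derivative b f (x + h *\<^sub>R b)) (at h)"
    by (intro vector_diff_chain_at) auto
  moreover have "(\<lambda>t. f ((x + h *\<^sub>R b) + t *\<^sub>R b)) \<circ> (\<lambda>t. t - h) = (\<lambda>t. f (x + t *\<^sub>R b))"
    by (simp add: fun_eq_iff scaleR_diff_left)
  ultimately show ?thesis
    by (simp only: scaleR_one has_vector_derivative_at_within)
qed

text \<open>\<open>C_k\<close> speaks of one coordinate direction at a time, whereas dilation moves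
  a point in all coordinates at once, so the chain rule needs a total derivative. The classical
  argument moves the coordinates one after another: induction on the set of coordinates already
  moved, with the mean value inequality and the continuity of one partial derivative for the next
  coordinate.\<close>

lemma C_k_has_derivative:
  fixes f :: "'a::euclidean_space \<Rightarrow> complex"
  assumes f: "C_k (Suc k) f"
  shows "(f has_derivative (\<lambda>h. \<Sum>b\<in>Basis. (h \<bullet> b) *\<^sub>R partial_derivative b f x)) (at x)"
proof -
  let ?P = "\<lambda>S h. (\<Sum>b\<in>S. (h \<bullet> b) *\<^sub>R b)"
  have cont: "continuous_on UNIV (partial_derivative b f)" if "b \<in> Basis" for b
    using f that by (cases k) auto
  have *: "\<exists>d>0. \<forall>h. norm h < d \<longrightarrow> norm (f (x + ?P S h) - f x - (\<Sum>b\<in>S. (h \<bullet> b) *\<^sub>R partial_derivative b f x))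
        \<le> e * norm h" if "e > 0" "S \<subseteq> Basis" for e and S :: "'a set"
  proof -
    have "finite S" using that(2) finite_Basis finite_subset by blast
    then show ?thesis using that
    proof (induction S arbitrary: e rule: finite_induct)
      case empty
      then show ?case by (intro exI[of _ 1]) auto
    next
      case (insert c S)
      then have c: "c \<in> Basis" by auto
      obtain d1 where d1: "d1 > 0" "\<And>h. norm h < d1 \<Longrightarrow>
          norm (f (x + ?P S h) - f x - (\<Sum>b\<in>S. (h \<bullet> b) *\<^sub>R partial_derivative b f x)) \<le> e / 2 * norm h"
        using insert.IH[of "e / 2"] insert.prems by auto
      obtain d2 where d2: "d2 > 0" "\<And>y. dist y x < d2 \<Longrightarrow>
          dist (partial_derivative c f y) (partial_derivative c f x) < e / 8"
        using cont[OF c] insert.prems(1) unfolding continuous_on_iff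
        by (metis UNIV_I divide_pos_pos zero_less_numeral)
      show ?case
      \<comment> \<open>Each coordinate of h is at most |h|, so moving along S and then by t along c
        displaces by at most (d + 1) |h|; the division keeps all points within \<open>d2\<close> of
        x. There two values of the new partial derivative differ by at most e / 4, both being within
        e / 8 of the value at x.\<close>
      proof (intro exI[of _ "min d1 (d2 / real (DIM('a) + 1))"] conjI allI impI)
        show "0 < min d1 (d2 / real (DIM('a) + 1))" using d1 d2 by auto
        fix h :: 'a
        assume h: "norm h < min d1 (d2 / real (DIM('a) + 1))"
        let ?y = "x + ?P S h" and ?D = "partial_derivative c f"
        have near: "dist (?y + t *\<^sub>R c) x < d2" if "t \<in> closed_segment 0 (h \<bullet> c)" for t
        proof -
          have "\<bar>t\<bar> \<le> \<bar>h \<bullet> c\<bar>" using segment_bound1[OF that] by simp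
          then have t: "\<bar>t\<bar> \<le> norm h" using Basis_le_norm[OF c, of h] by linarith
          have "norm (?P S h) \<le> (\<Sum>b\<in>S. norm h)"
            using insert.prems(2) by (intro sum_norm_le) (auto simp: Basis_le_norm)
          also have "\<dots> \<le> real DIM('a) * norm h"
            using insert.prems(2) by (auto intro!: mult_right_mono card_mono)
          finally have "norm (?P S h + t *\<^sub>R c) \<le> real DIM('a) * norm h + norm h"
            using t c by (intro order.trans[OF norm_triangle_ineq] add_mono) auto
          also have "\<dots> = norm h * real (DIM('a) + 1)" by (simp add: algebra_simps)
          also have "\<dots> < d2" using h by (simp add: pos_less_divide_eq)
          finally show ?thesis by (simp add: dist_norm add.assoc)
        qed
        have lin: "norm (f (?y + (h \<bullet> c) *\<^sub>R c) - f (?y + 0 *\<^sub>R c) - (h \<bullet> c - 0) *\<^sub>R ?D (?y + 0 *\<^sub>R c))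
            \<le> norm (h \<bullet> c - 0) * (e / 4)"
        proof (rule vector_differentiable_bound_linearization)
          show "((\<lambda>t. f (?y + t *\<^sub>R c)) has_vector_derivative ?D (?y + t *\<^sub>R c))
              (at t within closed_segment 0 (h \<bullet> c))" for t
            by (rule partial_derivative_along_line[OF f c])
          show "norm (?D (?y + t *\<^sub>R c) - ?D (?y + 0 *\<^sub>R c)) \<le> e / 4"
            if "t \<in> closed_segment 0 (h \<bullet> c)" for t
            using d2(2)[OF near[OF that]] d2(2)[OF near[of 0]]
              dist_triangle2[of "?D (?y + t *\<^sub>R c)" "?D (?y + 0 *\<^sub>R c)" "?D x"]
            by (simp add: dist_norm)
        qed auto
        have "norm (?D ?y - ?D x) \<le> e / 8"
          using d2(2)[OF near[of 0]] by (simp add: dist_norm)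
        then have corr: "norm ((h \<bullet> c) *\<^sub>R (?D ?y - ?D x)) \<le> norm h * (e / 8)"
          unfolding norm_scaleR by (intro mult_mono) (auto simp: Basis_le_norm[OF c])
        have le: "norm (h \<bullet> c - 0) * (e / 4) \<le> norm h * (e / 4)"
          using insert.prems(1) by (intro mult_right_mono) (auto simp: Basis_le_norm[OF c])
        \<comment> \<open>Three errors: linearisation in the new coordinate at the moved point
          \<open>?y\<close>, transport of its partial derivative from \<open>?y\<close> back to x,
          and the induction hypothesis. They are budgeted as e / 4, e / 8 and e / 2.\<close>
        have eq: "f (x + ?P (insert c S) h) - f x - (\<Sum>b\<in>insert c S. (h \<bullet> b) *\<^sub>R partial_derivative b f x)
            = (f (?y + (h \<bullet> c) *\<^sub>R c) - f ?y - (h \<bullet> c) *\<^sub>R ?D ?y) + (h \<bullet> c) *\<^sub>R (?D ?y - ?D x)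
              + (f ?y - f x - (\<Sum>b\<in>S. (h \<bullet> b) *\<^sub>R partial_derivative b f x))"
          using insert.hyps by (simp add: algebra_simps)
        show "norm (f (x + ?P (insert c S) h) - f x - (\<Sum>b\<in>insert c S. (h \<bullet> b) *\<^sub>R partial_derivative b f x))
            \<le> e * norm h"
          unfolding eq
        proof (rule order.trans[OF norm_triangle_mono[OF norm_triangle_mono]])
          show "norm (f (?y + (h \<bullet> c) *\<^sub>R c) - f ?y - (h \<bullet> c) *\<^sub>R ?D ?y) \<le> norm h * (e / 4)"
            using order.trans[OF lin le] by simp
          show "norm ((h \<bullet> c) *\<^sub>R (?D ?y - ?D x)) \<le> norm h * (e / 8)"
            by (rule corr)
          show "norm (f ?y - f x - (\<Sum>b\<in>S. (h \<bullet> b) *\<^sub>R partial_derivative b f x)) \<le> e / 2 * norm h"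
            using h by (intro d1) auto
          show "norm h * (e / 4) + norm h * (e / 8) + e / 2 * norm h \<le> e * norm h"
            using insert.prems(1) by (simp add: algebra_simps)
        qed
      qed
    qed
  qed
  show ?thesis
    unfolding has_derivative_at_alt
  proof (intro conjI allI impI)
    show "bounded_linear (\<lambda>h. \<Sum>b\<in>Basis. (h \<bullet> b) *\<^sub>R partial_derivative b f x)"
      by (intro bounded_linear_sum bounded_linear_scaleR_const bounded_linear_inner_left)
    fix e :: real assume "e > 0"
    from *[OF this subset_refl] obtain d where "d > 0" and d: "\<And>h. norm h < d \<Longrightarrow>
        norm (f (x + h) - f x - (\<Sum>b\<in>Basis. (h \<bullet> b) *\<^sub>R partial_derivative b f x)) \<le> e * norm h"
      by (auto simp: euclidean_representation)
    then show "\<exists>d>0. \<forall>y. norm (y - x) < d \<longrightarrow> norm (f y - f x -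
        (\<Sum>b\<in>Basis. ((y - x) \<bullet> b) *\<^sub>R partial_derivative b f x)) \<le> e * norm (y - x)"
      using d[of "y - x" for y] by (intro exI[of _ d]) auto
  qed
qed

section \<open>One dilation parameter: fundamental theorem of calculus and Cauchy-Schwarz\<close>

lemma square_le_nn_integral_square:
  assumes [measurable]: "g \<in> borel_measurable lborel" and "c \<le> d"
  shows "(\<integral>\<^sup>+u. g u * indicator {c..d} u \<partial>lborel)\<^sup>2 \<le> ennreal (d - c) * (\<integral>\<^sup>+u. (g u)\<^sup>2 * indicator {c..d} u \<partial>lborel)"
proof -
  have "(\<integral>\<^sup>+u. g u * indicator {c..d} u \<partial>lborel)\<^sup>2 = (\<integral>\<^sup>+u. (g u * indicator {c..d} u) * indicator {c..d} u \<partial>lborel)\<^sup>2"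
    by (intro arg_cong[where f = "\<lambda>x. x\<^sup>2"] nn_integral_cong) (simp add: indicator_def)
  also have "\<dots> \<le> (\<integral>\<^sup>+u. (g u * indicator {c..d} u)\<^sup>2 \<partial>lborel) * (\<integral>\<^sup>+u. (indicator {c..d} u)\<^sup>2 \<partial>lborel)"
    by (rule Cauchy_Schwarz_nn_integral) measurable
  also have "(\<integral>\<^sup>+u. (indicator {c..d} u)\<^sup>2 \<partial>lborel) = ennreal (d - c)"
  proof -
    have "(\<integral>\<^sup>+u. (indicator {c..d} u)\<^sup>2 \<partial>lborel) = (\<integral>\<^sup>+u. indicator {c..d} u \<partial>lborel)"
      by (intro nn_integral_cong) (simp add: indicator_def)
    then show ?thesis using \<open>c \<le> d\<close> by simp
  qed
  also have "(\<integral>\<^sup>+u. (g u * indicator {c..d} u)\<^sup>2 \<partial>lborel) = (\<integral>\<^sup>+u. (g u)\<^sup>2 * indicator {c..d} u \<partial>lborel)"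
    by (intro nn_integral_cong) (simp add: indicator_def)
  finally show ?thesis by (simp add: mult.commute)
qed

lemma sum_square_ennreal: "(x + y :: ennreal)\<^sup>2 \<le> 2 * x\<^sup>2 + 2 * y\<^sup>2"
proof (cases "x = \<top> \<or> y = \<top>")
  case True
  then have "2 * x\<^sup>2 + 2 * y\<^sup>2 = \<top>"
    by (auto simp: power2_eq_square ennreal_mult_eq_top_iff)
  then show ?thesis by (metis top_greatest)
next
  case False
  then obtain a b where ab: "x = ennreal a" "0 \<le> a" "y = ennreal b" "0 \<le> b"
    by (cases x rule: ennreal_cases; cases y rule: ennreal_cases) auto
  have "(a + b)\<^sup>2 \<le> 2 * a\<^sup>2 + 2 * b\<^sup>2"
    using sum_squares_bound[of a b] by (simp add: power2_sum)
  then have "ennreal ((a + b)\<^sup>2) \<le> ennreal (2 * a\<^sup>2 + 2 * b\<^sup>2)"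
    by (rule ennreal_leI)
  also have "\<dots> = 2 * x\<^sup>2 + 2 * y\<^sup>2"
    using ab by (simp add: ennreal_mult ennreal_power[symmetric])
  finally show ?thesis
    using ab by (simp add: ennreal_plus[symmetric] ennreal_power[symmetric] del: ennreal_plus)
qed

text \<open>The fundamental theorem of calculus in u, exchanged with the frequency integral,
  followed by Cauchy-Schwarz on the interval. The right-hand side does not contain t, so it bounds
  the supremum over the whole interval. The bounds \<open>B\<close> and \<open>B'\<close> only
  justify the integrals and the exchange; they do not enter the estimate.\<close>

lemma localized_bilinear_increment:
  fixes F G :: "'a::euclidean_space \<Rightarrow> complex" and n n' :: "real \<Rightarrow> 'a \<times> 'a \<Rightarrow> complex"
  assumes meas [measurable]: "F \<in> borel_measurable borel" "G \<in> borel_measurable borel" "A \<in> sets borel"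
    and A: "A \<subseteq> cball 0 M \<times> cball 0 M"
    and F: "\<And>\<xi>. cmod (F \<xi>) \<le> CF" and G: "\<And>\<eta>. cmod (G \<eta>) \<le> CG"
    and cont: "continuous_on UNIV (\<lambda>(u, z). n u z)" "continuous_on UNIV (\<lambda>(u, z). n' u z)"
    and deriv: "\<And>u z. ((\<lambda>u. n u z) has_vector_derivative n' u z) (at u)"
    and B: "\<And>u z. u \<in> {c..c + \<delta>} \<Longrightarrow> z \<in> A \<Longrightarrow> cmod (n u z) \<le> B"
    and B': "\<And>u z. u \<in> {c..c + \<delta>} \<Longrightarrow> z \<in> A \<Longrightarrow> cmod (n' u z) \<le> B'"
    and t: "t \<in> {c..c + \<delta>}"
  shows "(ennreal (cmod (localized_bilinear A F G (n t) x)))\<^sup>2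
    \<le> 2 * (ennreal (cmod (localized_bilinear A F G (n c) x)))\<^sup>2
      + 2 * (ennreal \<delta> * (\<integral>\<^sup>+u. (ennreal (cmod (localized_bilinear A F G (n' u) x)))\<^sup>2 * indicator {c..c + \<delta>} u \<partial>lborel))"
proof -
  define h where "h = (\<lambda>z. indicator A z * (F (fst z) * G (snd z)) * 1)"
  define w where "w = (\<lambda>z::'a \<times> 'a. wave (x \<bullet> (fst z + snd z)))"
  note [measurable] = borel_measurable_fst borel_measurable_snd
  have h: "integrable lborel h"
    unfolding h_def using A F G by (rule integrable_localized[of F G "\<lambda>_. 1" A M CF CG 1, rotated 4]) auto
  have hA: "h z = 0" if "z \<notin> A" for z using that by (simp add: h_def)
  have [measurable]: "h \<in> borel_measurable borel" using h by auto
  have [measurable]: "w \<in> borel_measurable borel" unfolding w_def by measurable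
  have prod_borel: "borel \<Otimes>\<^sub>M borel = (borel :: (real \<times> ('a \<times> 'a)) measure)"
    by (rule borel_prod)
  have n_m: "(\<lambda>(u, z). n u z) \<in> borel_measurable (borel \<Otimes>\<^sub>M borel)"
    "(\<lambda>(u, z). n' u z) \<in> borel_measurable (borel \<Otimes>\<^sub>M borel)"
    unfolding prod_borel by (intro borel_measurable_continuous_onI cont)+
  have [measurable]: "(\<lambda>p. n' (fst p) (snd p)) \<in> borel_measurable (lborel \<Otimes>\<^sub>M lborel)"
    using n_m(2) by (simp add: case_prod_beta' cong: measurable_cong_sets)
  have [measurable]: "n u \<in> borel_measurable borel" "n' u \<in> borel_measurable borel" for u
    using measurable_compose[OF measurable_Pair1' n_m(1), of u] measurable_compose[OF measurable_Pair1' n_m(2), of u]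
    by simp_all
  have L: "localized_bilinear A F G k x = (LINT z|lborel. h z * k z * w z)" for k
    unfolding localized_bilinear_def h_def w_def by simp
  have int: "integrable lborel (\<lambda>z. h z * n u z * w z)" if "u \<in> {c..c + \<delta>}" for u
  proof (rule Bochner_Integration.integrable_bound[OF integrable_mult_left[OF h, of "complex_of_real B"]])
    show "AE z in lborel. norm (h z * n u z * w z) \<le> norm (h z * complex_of_real B)"
    proof (rule AE_I2)
      fix z
      show "norm (h z * n u z * w z) \<le> norm (h z * complex_of_real B)"
        using B[OF that, of z] hA[of z]
        by (cases "z \<in> A") (auto simp: norm_mult w_def intro!: mult_left_mono)
    qed
  qed measurable
  have cn': "continuous_on S (\<lambda>u. n' u z)" for S z
  proof -
    have "continuous_on S ((\<lambda>(u, z). n' u z) \<circ> (\<lambda>u. (u, z)))"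
      by (intro continuous_on_compose continuous_intros continuous_on_subset[OF cont(2)]) auto
    then show ?thesis by (simp add: o_def)
  qed
  have FTC: "n t z - n c z = (LINT u|lborel. indicator {c..t} u *\<^sub>R n' u z)" for z
    using t by (subst integral_FTC_Icc[where F = "\<lambda>u. n u z"])
      (auto intro: has_vector_derivative_at_within deriv cn')
  let ?k = "\<lambda>u z. (indicator {c..t} u *\<^sub>R n' u z) * (h z * w z)"
  \<comment> \<open>The domination is by \<open>B'\<close> times |h| on the interval, which is a
    product of an integrable function of u and one of z. Outside \<open>A\<close>, where
    \<open>B'\<close> says nothing, h vanishes.\<close>
  have k: "integrable (lborel \<Otimes>\<^sub>M lborel) (case_prod ?k)"
  proof (rule Bochner_Integration.integrable_bound)
    have "integrable (lborel \<Otimes>\<^sub>M lborel) (\<lambda>(u::real, z). indicator {c..t} u * (B' * norm (h z)))"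
    proof (rule lborel_pair.Fubini_integrable)
      show "integrable lborel (\<lambda>u. LINT z|lborel. norm (case (u, z) of (u::real, z) \<Rightarrow> indicator {c..t} u * (B' * norm (h z))))"
        using t by (simp add: abs_mult integrable_indicator_iff)
      show "AE u in lborel. integrable lborel (\<lambda>z. case (u, z) of (u::real, z) \<Rightarrow> indicator {c..t} u * (B' * norm (h z)))"
        using h by auto
    qed measurable
    then show "integrable (lborel \<Otimes>\<^sub>M lborel) (\<lambda>p. indicator {c..t} (fst p) * (B' * norm (h (snd p))))"
      by (simp add: case_prod_beta')
    show "AE p in lborel \<Otimes>\<^sub>M lborel. norm (case_prod ?k p) \<le> norm (indicator {c..t} (fst p) * (B' * norm (h (snd p))))"
    proof (intro AE_I2, clarify)
      fix u z
      show "norm (?k u z) \<le> norm (indicator {c..t} (fst (u, z)) * (B' * norm (h (snd (u, z)))))"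
        using B'[of u z] hA[of z] t
        by (cases "z \<in> A"; cases "u \<in> {c..t}") (auto simp: norm_mult w_def abs_mult intro!: mult_right_mono)
    qed
  qed measurable
  have "localized_bilinear A F G (n t) x - localized_bilinear A F G (n c) x
      = (LINT z|lborel. h z * n t z * w z - h z * n c z * w z)"
    unfolding L using t by (intro Bochner_Integration.integral_diff[symmetric] int) auto
  also have "\<dots> = (LINT z|lborel. (LINT u|lborel. indicator {c..t} u *\<^sub>R n' u z) * (h z * w z))"
    unfolding FTC[symmetric] by (simp add: algebra_simps)
  also have "\<dots> = (LINT z|lborel. LINT u|lborel. ?k u z)"
    unfolding integral_mult_left_zero ..
  also have "\<dots> = (LINT u|lborel. LINT z|lborel. ?k u z)"
    by (rule lborel_pair.Fubini_integral[OF k])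
  also have "\<dots> = (LINT u|lborel. indicator {c..t} u *\<^sub>R localized_bilinear A F G (n' u) x)"
  proof (intro Bochner_Integration.integral_cong refl)
    fix u
    have "?k u z = indicator {c..t} u *\<^sub>R (h z * n' u z * w z)" for z
      by (simp add: mult_ac)
    then show "(LINT z|lborel. ?k u z) = indicator {c..t} u *\<^sub>R localized_bilinear A F G (n' u) x"
      unfolding L integral_scaleR_right[symmetric] by (simp only:)
  qed
  finally have diff: "localized_bilinear A F G (n t) x - localized_bilinear A F G (n c) x
      = (LINT u|lborel. indicator {c..t} u *\<^sub>R localized_bilinear A F G (n' u) x)" .
  have [measurable]: "(\<lambda>u. localized_bilinear A F G (n' u) x) \<in> borel_measurable lborel"
    by (rule borel_measurable_localized_bilinear) (use n_m(2) in \<open>simp_all cong: measurable_cong_sets\<close>)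
  let ?g = "\<lambda>u. ennreal (cmod (localized_bilinear A F G (n' u) x))"
  have "ennreal (cmod (localized_bilinear A F G (n t) x - localized_bilinear A F G (n c) x))
      \<le> (\<integral>\<^sup>+u. ennreal (cmod (indicator {c..t} u *\<^sub>R localized_bilinear A F G (n' u) x)) \<partial>lborel)"
    unfolding diff by (rule norm_integral_le_nn_integral)
  also have "\<dots> \<le> (\<integral>\<^sup>+u. ?g u * indicator {c..c + \<delta>} u \<partial>lborel)"
    using t by (intro nn_integral_mono) (auto simp: indicator_def)
  finally have inc: "ennreal (cmod (localized_bilinear A F G (n t) x - localized_bilinear A F G (n c) x))
      \<le> (\<integral>\<^sup>+u. ?g u * indicator {c..c + \<delta>} u \<partial>lborel)" .
  have "ennreal (cmod (localized_bilinear A F G (n t) x))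
      \<le> ennreal (cmod (localized_bilinear A F G (n c) x)
          + cmod (localized_bilinear A F G (n t) x - localized_bilinear A F G (n c) x))"
    by (intro ennreal_leI) (metis norm_triangle_sub)
  also have "\<dots> \<le> ennreal (cmod (localized_bilinear A F G (n c) x)) + (\<integral>\<^sup>+u. ?g u * indicator {c..c + \<delta>} u \<partial>lborel)"
    using inc by (simp add: ennreal_plus add_left_mono)
  finally have "(ennreal (cmod (localized_bilinear A F G (n t) x)))\<^sup>2
      \<le> (ennreal (cmod (localized_bilinear A F G (n c) x)) + (\<integral>\<^sup>+u. ?g u * indicator {c..c + \<delta>} u \<partial>lborel))\<^sup>2"
    by (rule power_mono) simp
  also have "\<dots> \<le> 2 * (ennreal (cmod (localized_bilinear A F G (n c) x)))\<^sup>2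
      + 2 * (\<integral>\<^sup>+u. ?g u * indicator {c..c + \<delta>} u \<partial>lborel)\<^sup>2"
    by (rule sum_square_ennreal)
  also have "(\<integral>\<^sup>+u. ?g u * indicator {c..c + \<delta>} u \<partial>lborel)\<^sup>2
      \<le> ennreal (c + \<delta> - c) * (\<integral>\<^sup>+u. (?g u)\<^sup>2 * indicator {c..c + \<delta>} u \<partial>lborel)"
    using t by (intro square_le_nn_integral_square) auto
  finally show ?thesis by (simp add: mult_left_mono add_left_mono)
qed

section \<open>Derivatives of the dilated multiplier in its parameters\<close>

definition dilate_fst ::
    "real \<Rightarrow> real \<Rightarrow> ('a::euclidean_space \<times> 'a \<Rightarrow> complex) \<Rightarrow> 'a \<times> 'a \<Rightarrow> complex" where
  "dilate_fst t\<^sub>1 t\<^sub>2 m z =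
    (\<Sum>b\<in>Basis. (fst z \<bullet> b) *\<^sub>R dilate t\<^sub>1 t\<^sub>2 (partial_derivative (b, 0) m) z)"

definition dilate_snd ::
    "real \<Rightarrow> real \<Rightarrow> ('a::euclidean_space \<times> 'a \<Rightarrow> complex) \<Rightarrow> 'a \<times> 'a \<Rightarrow> complex" where
  "dilate_snd t\<^sub>1 t\<^sub>2 m z =
    (\<Sum>b\<in>Basis. (snd z \<bullet> b) *\<^sub>R dilate t\<^sub>1 t\<^sub>2 (partial_derivative (0, b) m) z)"

text \<open>By the chain rule the two preceding functions are the derivatives of
  \<open>dilate\<close> in \<open>t\<^sub>1\<close> and \<open>t\<^sub>2\<close>, that is, \<xi> and
  \<eta> paired with the corresponding partial gradients of m at the dilated point; this one is the
  mixed second derivative. The frequencies in front are undilated, so on a cut-off of radius M each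
  derivative costs at most d M. Differentiation is in \<open>fst\<close> and then in
  \<open>snd\<close>, which matches the list \<open>[(0, b'), (b, 0)]\<close> in
  \<open>iterated_partial\<close> without any appeal to symmetry.\<close>

definition dilate_fst_snd ::
    "real \<Rightarrow> real \<Rightarrow> ('a::euclidean_space \<times> 'a \<Rightarrow> complex) \<Rightarrow> 'a \<times> 'a \<Rightarrow> complex" where
  "dilate_fst_snd t\<^sub>1 t\<^sub>2 m z =
    (\<Sum>b\<in>Basis. (fst z \<bullet> b) *\<^sub>R dilate_snd t\<^sub>1 t\<^sub>2 (partial_derivative (b, 0) m) z)"

lemma sum_Basis_prod:
  fixes f :: "'a::euclidean_space \<times> 'b::euclidean_space \<Rightarrow> 'c::comm_monoid_add"
  shows "sum f Basis = (\<Sum>b\<in>Basis. f (b, 0)) + (\<Sum>b\<in>Basis. f (0, b))"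
proof -
  have "inj_on (\<lambda>u. (u::'a, 0::'b)) Basis" "inj_on (\<lambda>u. (0::'a, u::'b)) Basis"
    by (auto intro!: inj_onI)
  then show ?thesis
    unfolding Basis_prod_def by (subst sum.union_disjoint) (auto simp: sum.reindex)
qed

lemma has_vector_derivative_dilate:
  fixes m :: "'a::euclidean_space \<times> 'a \<Rightarrow> complex"
  assumes "C_k (Suc k) m"
  shows "((\<lambda>t. dilate t t\<^sub>2 m z) has_vector_derivative dilate_fst t\<^sub>1 t\<^sub>2 m z) (at t\<^sub>1)"
    and "((\<lambda>t. dilate t\<^sub>1 t m z) has_vector_derivative dilate_snd t\<^sub>1 t\<^sub>2 m z) (at t\<^sub>2)"
proof -
  obtain \<xi> \<eta> where z: "z = (\<xi>, \<eta>)" by (cases z)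
  let ?D = "\<lambda>y h. \<Sum>b\<in>Basis. (h \<bullet> b) *\<^sub>R partial_derivative b m y"
  have D: "?D y (h\<^sub>1, h\<^sub>2) = (\<Sum>b\<in>Basis. (h\<^sub>1 \<bullet> b) *\<^sub>R partial_derivative (b, 0) m y)
      + (\<Sum>b\<in>Basis. (h\<^sub>2 \<bullet> b) *\<^sub>R partial_derivative (0, b) m y)" for y and h\<^sub>1 h\<^sub>2 :: 'a
    by (subst sum_Basis_prod) simp
  have "((\<lambda>t. (t *\<^sub>R \<xi>, t\<^sub>2 *\<^sub>R \<eta>)) has_vector_derivative (\<xi>, 0)) (at t\<^sub>1)"
    by (auto intro!: derivative_eq_intros has_vector_derivative_Pair)
  from vector_derivative_diff_chain_within[OF this, of m "?D (t\<^sub>1 *\<^sub>R \<xi>, t\<^sub>2 *\<^sub>R \<eta>)"]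
  show "((\<lambda>t. dilate t t\<^sub>2 m z) has_vector_derivative dilate_fst t\<^sub>1 t\<^sub>2 m z) (at t\<^sub>1)"
    using C_k_has_derivative[OF assms, of "(t\<^sub>1 *\<^sub>R \<xi>, t\<^sub>2 *\<^sub>R \<eta>)"]
    by (simp add: has_derivative_at_withinI D z dilate_def dilate_fst_def o_def)
  have "((\<lambda>t. (t\<^sub>1 *\<^sub>R \<xi>, t *\<^sub>R \<eta>)) has_vector_derivative (0, \<eta>)) (at t\<^sub>2)"
    by (auto intro!: derivative_eq_intros has_vector_derivative_Pair)
  from vector_derivative_diff_chain_within[OF this, of m "?D (t\<^sub>1 *\<^sub>R \<xi>, t\<^sub>2 *\<^sub>R \<eta>)"]
  show "((\<lambda>t. dilate t\<^sub>1 t m z) has_vector_derivative dilate_snd t\<^sub>1 t\<^sub>2 m z) (at t\<^sub>2)"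
    using C_k_has_derivative[OF assms, of "(t\<^sub>1 *\<^sub>R \<xi>, t\<^sub>2 *\<^sub>R \<eta>)"]
    by (simp add: has_derivative_at_withinI D z dilate_def dilate_snd_def o_def)
qed

lemma C_k_partial_derivative: "C_k (Suc k) m \<Longrightarrow> b \<in> Basis \<Longrightarrow> C_k k (partial_derivative b m)"
  by auto

lemma C_k_continuous: "C_k k m \<Longrightarrow> continuous_on UNIV m"
  by (cases k) auto

lemma has_vector_derivative_dilate_fst:
  fixes m :: "'a::euclidean_space \<times> 'a \<Rightarrow> complex"
  assumes "C_k (Suc (Suc k)) m"
  shows "((\<lambda>t. dilate_fst t\<^sub>1 t m z) has_vector_derivative dilate_fst_snd t\<^sub>1 t\<^sub>2 m z) (at t\<^sub>2)"
  unfolding dilate_fst_def dilate_fst_snd_def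
proof (intro has_vector_derivative_sum)
  fix b :: 'a assume "b \<in> Basis"
  then have "C_k (Suc k) (partial_derivative (b, 0) m)"
    by (intro C_k_partial_derivative assms) (simp add: Basis_prod_def)
  from has_vector_derivative_scaleR[OF DERIV_const has_vector_derivative_dilate(2)[OF this], of "fst z \<bullet> b"]
  show "((\<lambda>t. (fst z \<bullet> b) *\<^sub>R dilate t\<^sub>1 t (partial_derivative (b, 0) m) z) has_vector_derivative
      (fst z \<bullet> b) *\<^sub>R dilate_snd t\<^sub>1 t\<^sub>2 (partial_derivative (b, 0) m) z) (at t\<^sub>2)"
    by simp
qed

lemma C_k_SucD: "C_k (Suc k) m \<Longrightarrow> C_k k m"
  by (induction k arbitrary: m) auto

lemma continuous_on_dilate:
  assumes "continuous_on UNIV m" "continuous_on S f" "continuous_on S g" "continuous_on S h"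
  shows "continuous_on S (\<lambda>p. dilate (f p) (g p) m (h p))"
proof -
  have "dilate (f p) (g p) m (h p) = m (f p *\<^sub>R fst (h p), g p *\<^sub>R snd (h p))" for p
    by (cases "h p") (simp add: dilate_def)
  then show ?thesis
    by (auto intro!: continuous_on_compose2[OF assms(1)] continuous_intros assms)
qed

lemma continuous_on_dilate_fst:
  assumes "C_k (Suc k) m" "continuous_on S f" "continuous_on S g" "continuous_on S h"
  shows "continuous_on S (\<lambda>p. dilate_fst (f p) (g p) m (h p))"
  unfolding dilate_fst_def
  by (intro continuous_intros continuous_on_dilate assms C_k_continuous[OF C_k_partial_derivative[OF assms(1)]])
    (simp add: Basis_prod_def)

lemma continuous_on_dilate_snd:
  assumes "C_k (Suc k) m" "continuous_on S f" "continuous_on S g" "continuous_on S h"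
  shows "continuous_on S (\<lambda>p. dilate_snd (f p) (g p) m (h p))"
  unfolding dilate_snd_def
  by (intro continuous_intros continuous_on_dilate assms C_k_continuous[OF C_k_partial_derivative[OF assms(1)]])
    (simp add: Basis_prod_def)

lemma continuous_on_dilate_fst_snd:
  assumes "C_k (Suc (Suc k)) m" "continuous_on S f" "continuous_on S g" "continuous_on S h"
  shows "continuous_on S (\<lambda>p. dilate_fst_snd (f p) (g p) m (h p))"
  unfolding dilate_fst_snd_def
  by (intro continuous_intros continuous_on_dilate_snd[OF C_k_partial_derivative[OF assms(1)]] assms)
    (simp add: Basis_prod_def)

text \<open>Tonelli's theorem gives one factor \<delta>; Cauchy-Schwarz in the increment estimate
  gives the other. Together they make each derivative term quadratic in \<delta> times the size of
  the derivative, hence comparable with the term without derivative.\<close>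

lemma nn_integral_average_le:
  fixes g :: "'x::euclidean_space \<Rightarrow> real \<Rightarrow> ennreal"
  assumes [measurable]: "(\<lambda>(x, u). g x u) \<in> borel_measurable (lborel \<Otimes>\<^sub>M lborel)"
    and g: "\<And>u. u \<in> {c..c + \<delta>} \<Longrightarrow> (\<integral>\<^sup>+x. g x u \<partial>lborel) \<le> \<Theta>" and "\<delta> \<ge> 0"
  shows "(\<integral>\<^sup>+x. \<integral>\<^sup>+u. g x u * indicator {c..c + \<delta>} u \<partial>lborel \<partial>lborel) \<le> ennreal \<delta> * \<Theta>"
proof -
  have "(\<integral>\<^sup>+x. \<integral>\<^sup>+u. g x u * indicator {c..c + \<delta>} u \<partial>lborel \<partial>lborel)
      = (\<integral>\<^sup>+u. \<integral>\<^sup>+x. g x u * indicator {c..c + \<delta>} u \<partial>lborel \<partial>lborel)"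
    by (rule lborel_pair.Fubini'[symmetric]) measurable
  also have "\<dots> \<le> (\<integral>\<^sup>+u. \<Theta> * indicator {c..c + \<delta>} u \<partial>lborel)"
    by (intro nn_integral_mono) (auto simp: indicator_def intro: g)
  also have "\<dots> = ennreal \<delta> * \<Theta>"
    using \<open>\<delta> \<ge> 0\<close> by (simp add: nn_integral_cmult_indicator mult.commute)
  finally show ?thesis .
qed

lemma norm_sum_coordinates_le:
  fixes v :: "'a::euclidean_space" and c :: "'a \<Rightarrow> complex"
  assumes "norm v \<le> M" "\<And>b. b \<in> Basis \<Longrightarrow> cmod (c b) \<le> W"
  shows "cmod (\<Sum>b\<in>Basis. (v \<bullet> b) *\<^sub>R c b) \<le> real DIM('a) * M * W"
proof -
  have "cmod (\<Sum>b\<in>Basis. (v \<bullet> b) *\<^sub>R c b) \<le> (\<Sum>b\<in>(Basis::'a set). M * W)"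
  proof (intro sum_norm_le)
    fix b :: 'a assume b: "b \<in> Basis"
    have "\<bar>v \<bullet> b\<bar> \<le> M" using Basis_le_norm[OF b, of v] assms(1) by linarith
    then show "cmod ((v \<bullet> b) *\<^sub>R c b) \<le> M * W"
      using assms(2)[OF b] unfolding norm_scaleR by (intro mult_mono) auto
  qed
  then show ?thesis by simp
qed

text \<open>Substituting measurable functions for all three arguments covers every mixture of fixed
  and integrated parameters that occurs in the iterated integrals of the two-parameter
  estimate.\<close>

lemma borel_measurable_localized_family:
  fixes n :: "real \<Rightarrow> real \<Rightarrow> 'a::euclidean_space \<times> 'a \<Rightarrow> complex"
  assumes meas: "F \<in> borel_measurable borel" "G \<in> borel_measurable borel" "A \<in> sets borel"
    and n: "continuous_on UNIV (\<lambda>(t\<^sub>1, t\<^sub>2, z). n t\<^sub>1 t\<^sub>2 z)"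
    and [measurable]: "f \<in> borel_measurable N" "g \<in> borel_measurable N" "h \<in> borel_measurable N"
  shows "(\<lambda>p. localized_bilinear A F G (n (f p) (g p)) (h p)) \<in> borel_measurable N"
proof (rule borel_measurable_localized_bilinear[OF meas])
  have "(\<lambda>(t\<^sub>1, t\<^sub>2, z). n t\<^sub>1 t\<^sub>2 z) \<in> borel_measurable (borel \<Otimes>\<^sub>M (borel \<Otimes>\<^sub>M borel))"
    unfolding borel_prod by (rule borel_measurable_continuous_onI[OF n])
  from measurable_compose[OF _ this, of "\<lambda>(p, z). (f p, g p, z)" "N \<Otimes>\<^sub>M borel"]
  show "(\<lambda>(p, z). n (f p) (g p) z) \<in> borel_measurable (N \<Otimes>\<^sub>M borel)"
    by (simp add: case_prod_beta')
qed measurable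

text \<open>A two-parameter Sobolev embedding: the increment estimate in \<open>t\<^sub>1\<close>,
  then in \<open>t\<^sub>2\<close> on both resulting terms. With y = \<delta> d M, the four terms
  contribute 1, y^2, y^2 and y^4, whose sum is the square of 1 + y^2. The factor 8 is 2 * 2 from the
  two increments times 2 from the \<open>L\<^sup>2\<close> bound. A measurable majorant takes the
  place of the supremum because it can be integrated and summed freely.\<close>

lemma square_maximal_bound:
  fixes F G :: "'a::euclidean_space \<Rightarrow> complex" and m :: "'a \<times> 'a \<Rightarrow> complex"
  assumes meas [measurable]: "F \<in> borel_measurable borel" "G \<in> borel_measurable borel" "A \<in> sets borel"
    and A: "A \<subseteq> cball 0 M \<times> cball 0 M"
    and F: "\<And>\<xi>. cmod (F \<xi>) \<le> CF" and G: "\<And>\<eta>. cmod (G \<eta>) \<le> CG"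
    and m: "C_k 2 m"
    and W: "\<And>bs t\<^sub>1 t\<^sub>2 z. set bs \<subseteq> Basis \<Longrightarrow> length bs \<le> 2 \<Longrightarrow> t\<^sub>1 \<ge> 1 \<Longrightarrow> t\<^sub>2 \<ge> 1 \<Longrightarrow> z \<in> A \<Longrightarrow>
        cmod (dilate t\<^sub>1 t\<^sub>2 (iterated_partial bs m) z) \<le> W"
    and c: "c\<^sub>1 \<ge> 1" "c\<^sub>2 \<ge> 1" and \<delta>: "\<delta> \<ge> 0"
  obtains S where "S \<in> borel_measurable (borel :: 'a measure)"
    and "\<And>t\<^sub>1 t\<^sub>2 x. t\<^sub>1 \<in> {c\<^sub>1..c\<^sub>1 + \<delta>} \<Longrightarrow> t\<^sub>2 \<in> {c\<^sub>2..c\<^sub>2 + \<delta>} \<Longrightarrow>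
        (ennreal (cmod (localized_bilinear A F G (dilate t\<^sub>1 t\<^sub>2 m) x)))\<^sup>2 \<le> S x"
    and "(\<integral>\<^sup>+x. S x \<partial>lborel) \<le> ennreal (8 * W\<^sup>2 * (1 + (\<delta> * real DIM('a) * M)\<^sup>2)\<^sup>2)
        * (emeasure lborel (cball 0 M :: 'a set) * local_energy F M * local_energy G M)"
proof -
  let ?L = "\<lambda>n x. (ennreal (cmod (localized_bilinear A F G n x)))\<^sup>2"
  let ?I1 = "{c\<^sub>1..c\<^sub>1 + \<delta>}" and ?I2 = "{c\<^sub>2..c\<^sub>2 + \<delta>}"
  let ?d = "real DIM('a)"
  let ?E = "emeasure lborel (cball 0 M :: 'a set) * local_energy F M * local_energy G M"
  have m2: "C_k (Suc (Suc 0)) m" using m by (simp add: numeral_2_eq_2)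
  have m1: "C_k (Suc 0) m" using m2 by (rule C_k_SucD)
  have m0: "continuous_on UNIV m" using C_k_continuous[OF m] .
  have b0: "cmod (dilate t\<^sub>1 t\<^sub>2 m z) \<le> W" if "t\<^sub>1 \<ge> 1" "t\<^sub>2 \<ge> 1" "z \<in> A" for t\<^sub>1 t\<^sub>2 z
    using W[of "[]"] that by simp
  have b1: "cmod (dilate_fst t\<^sub>1 t\<^sub>2 m z) \<le> ?d * M * W" if "t\<^sub>1 \<ge> 1" "t\<^sub>2 \<ge> 1" "z \<in> A" for t\<^sub>1 t\<^sub>2 z
    unfolding dilate_fst_def
  proof (rule norm_sum_coordinates_le)
    show "norm (fst z) \<le> M" using A that by auto
    show "cmod (dilate t\<^sub>1 t\<^sub>2 (partial_derivative (b, 0) m) z) \<le> W" if "b \<in> Basis" for b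
      using W[of "[(b, 0)]"] that \<open>t\<^sub>1 \<ge> 1\<close> \<open>t\<^sub>2 \<ge> 1\<close> \<open>z \<in> A\<close> by (simp add: Basis_prod_def)
  qed
  have b2: "cmod (dilate_snd t\<^sub>1 t\<^sub>2 m z) \<le> ?d * M * W" if "t\<^sub>1 \<ge> 1" "t\<^sub>2 \<ge> 1" "z \<in> A" for t\<^sub>1 t\<^sub>2 z
    unfolding dilate_snd_def
  proof (rule norm_sum_coordinates_le)
    show "norm (snd z) \<le> M" using A that by auto
    show "cmod (dilate t\<^sub>1 t\<^sub>2 (partial_derivative (0, b) m) z) \<le> W" if "b \<in> Basis" for b
      using W[of "[(0, b)]"] that \<open>t\<^sub>1 \<ge> 1\<close> \<open>t\<^sub>2 \<ge> 1\<close> \<open>z \<in> A\<close> by (simp add: Basis_prod_def)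
  qed
  have b12: "cmod (dilate_fst_snd t\<^sub>1 t\<^sub>2 m z) \<le> ?d * M * (?d * M * W)"
    if "t\<^sub>1 \<ge> 1" "t\<^sub>2 \<ge> 1" "z \<in> A" for t\<^sub>1 t\<^sub>2 z
    unfolding dilate_fst_snd_def
  proof (rule norm_sum_coordinates_le)
    show "norm (fst z) \<le> M" using A that by auto
    show "cmod (dilate_snd t\<^sub>1 t\<^sub>2 (partial_derivative (b, 0) m) z) \<le> ?d * M * W" if b: "b \<in> Basis" for b
      unfolding dilate_snd_def
    proof (rule norm_sum_coordinates_le)
      show "norm (snd z) \<le> M" using A \<open>z \<in> A\<close> by auto
      show "cmod (dilate t\<^sub>1 t\<^sub>2 (partial_derivative (0, b') (partial_derivative (b, 0) m)) z) \<le> W"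
        if "b' \<in> Basis" for b'
        using W[of "[(0, b'), (b, 0)]"] that b \<open>t\<^sub>1 \<ge> 1\<close> \<open>t\<^sub>2 \<ge> 1\<close> \<open>z \<in> A\<close> by (simp add: Basis_prod_def)
    qed
  qed
  have c0: "continuous_on UNIV (\<lambda>(t\<^sub>1, t\<^sub>2, z). dilate t\<^sub>1 t\<^sub>2 m z)"
    and c1: "continuous_on UNIV (\<lambda>(t\<^sub>1, t\<^sub>2, z). dilate_fst t\<^sub>1 t\<^sub>2 m z)"
    and c2: "continuous_on UNIV (\<lambda>(t\<^sub>1, t\<^sub>2, z). dilate_snd t\<^sub>1 t\<^sub>2 m z)"
    and c12: "continuous_on UNIV (\<lambda>(t\<^sub>1, t\<^sub>2, z). dilate_fst_snd t\<^sub>1 t\<^sub>2 m z)"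
    unfolding case_prod_beta'
    by (intro continuous_on_dilate[OF m0] continuous_on_dilate_fst[OF m1] continuous_on_dilate_snd[OF m1]
        continuous_on_dilate_fst_snd[OF m2] continuous_intros)+
  note [measurable (raw)] = borel_measurable_localized_family[OF meas c0]
    borel_measurable_localized_family[OF meas c1] borel_measurable_localized_family[OF meas c2]
    borel_measurable_localized_family[OF meas c12]
  have L2: "(\<integral>\<^sup>+x. ?L n x \<partial>lborel) \<le> 2 * (ennreal (B\<^sup>2) * ?E)"
    if "n \<in> borel_measurable borel" "\<And>z. z \<in> A \<Longrightarrow> cmod (n z) \<le> B" for n B
    using localized_bilinear_L2[OF meas(1,2) that(1) meas(3) A F G that(2)]
    by (simp add: ennreal_power)
  have n_meas: "n t\<^sub>1 t\<^sub>2 \<in> borel_measurable borel" if "continuous_on UNIV (\<lambda>(t\<^sub>1, t\<^sub>2, z). n t\<^sub>1 t\<^sub>2 z)"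
    for t\<^sub>1 t\<^sub>2 and n :: "real \<Rightarrow> real \<Rightarrow> 'a \<times> 'a \<Rightarrow> complex"
  proof (rule borel_measurable_continuous_onI)
    have "continuous_on UNIV (\<lambda>z. (\<lambda>(t\<^sub>1, t\<^sub>2, z). n t\<^sub>1 t\<^sub>2 z) (t\<^sub>1, t\<^sub>2, z))"
      by (rule continuous_on_compose2[OF that]) (auto intro!: continuous_intros)
    then show "continuous_on UNIV (n t\<^sub>1 t\<^sub>2)" by simp
  qed
  \<comment> \<open>The value at the corner of the parameter square, one integral along each of the
    two edges through that corner, and the mixed derivative integrated over the whole
    square.\<close>
  define S0 where "S0 = (\<lambda>x. ?L (dilate c\<^sub>1 c\<^sub>2 m) x)"
  define S1 where "S1 = (\<lambda>x. \<integral>\<^sup>+u. ?L (dilate_fst u c\<^sub>2 m) x * indicator ?I1 u \<partial>lborel)"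
  define S2 where "S2 = (\<lambda>x. \<integral>\<^sup>+v. ?L (dilate_snd c\<^sub>1 v m) x * indicator ?I2 v \<partial>lborel)"
  define S12 where "S12 = (\<lambda>x. \<integral>\<^sup>+u. (\<integral>\<^sup>+v. ?L (dilate_fst_snd u v m) x * indicator ?I2 v \<partial>lborel) * indicator ?I1 u \<partial>lborel)"
  have [measurable]: "S0 \<in> borel_measurable borel" "S1 \<in> borel_measurable borel"
      "S2 \<in> borel_measurable borel" "S12 \<in> borel_measurable borel"
    unfolding S0_def S1_def S2_def S12_def by measurable
  define D where "D = ennreal \<delta>"
  define S where "S = (\<lambda>x. 4 * S0 x + 4 * (D * S1 x) + 4 * (D * S2 x) + 4 * (D * (D * S12 x)))"
  show thesis
  proof (rule that)
    show "S \<in> borel_measurable borel" unfolding S_def by measurable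
  next
    fix t\<^sub>1 t\<^sub>2 x assume t: "t\<^sub>1 \<in> ?I1" "t\<^sub>2 \<in> ?I2"
    have ge1: "u \<ge> 1" if "u \<in> ?I1" for u using that c by simp
    have ge2: "v \<ge> 1" if "v \<in> ?I2" for v using that c by simp
    have sub: "continuous_on UNIV (\<lambda>(u, z). n (f u) (g u) z)"
      if "continuous_on UNIV (\<lambda>(t\<^sub>1, t\<^sub>2, z). n t\<^sub>1 t\<^sub>2 z)" "continuous_on UNIV f" "continuous_on UNIV g"
      for n :: "real \<Rightarrow> real \<Rightarrow> 'a \<times> 'a \<Rightarrow> complex" and f g :: "real \<Rightarrow> real"
    proof -
      have "continuous_on UNIV (\<lambda>p. (\<lambda>(t\<^sub>1, t\<^sub>2, z). n t\<^sub>1 t\<^sub>2 z) (f (fst p), g (fst p), snd p))"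
        by (rule continuous_on_compose2[OF that(1)])
          (auto intro!: continuous_intros continuous_on_compose2[OF that(2)] continuous_on_compose2[OF that(3)])
      then show ?thesis by (simp add: case_prod_beta')
    qed
    have inc1: "?L (dilate t\<^sub>1 t\<^sub>2 m) x \<le> 2 * ?L (dilate c\<^sub>1 t\<^sub>2 m) x
        + 2 * (D * (\<integral>\<^sup>+u. ?L (dilate_fst u t\<^sub>2 m) x * indicator ?I1 u \<partial>lborel))"
      unfolding D_def using t ge1 ge2
      by (intro localized_bilinear_increment[OF meas A F G, where B = W and B' = "?d * M * W"]
          sub[OF c0] sub[OF c1] continuous_intros has_vector_derivative_dilate(1)[OF m1] b0 b1) auto
    have inc2: "?L (dilate c\<^sub>1 t\<^sub>2 m) x \<le> 2 * S0 x + 2 * (D * S2 x)"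
      unfolding D_def S0_def S2_def using t ge1 ge2 c
      by (intro localized_bilinear_increment[OF meas A F G, where B = W and B' = "?d * M * W"]
          sub[OF c0] sub[OF c2] continuous_intros has_vector_derivative_dilate(2)[OF m1] b0 b2) auto
    \<comment> \<open>After the first increment, the edge integral over u still runs at height
      \<open>t\<^sub>2\<close>. It is lowered to \<open>c\<^sub>2\<close> inside the u-integral,
      separately for each u.\<close>
    have inc3: "?L (dilate_fst u t\<^sub>2 m) x \<le> 2 * ?L (dilate_fst u c\<^sub>2 m) x
        + 2 * (D * (\<integral>\<^sup>+v. ?L (dilate_fst_snd u v m) x * indicator ?I2 v \<partial>lborel))" if "u \<in> ?I1" for u
      unfolding D_def using t ge1 ge2 that
      by (intro localized_bilinear_increment[OF meas A F G, where B = "?d * M * W" and B' = "?d * M * (?d * M * W)"]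
          sub[OF c1] sub[OF c12] continuous_intros has_vector_derivative_dilate_fst[OF m2] b1 b12) auto
    have "(\<integral>\<^sup>+u. ?L (dilate_fst u t\<^sub>2 m) x * indicator ?I1 u \<partial>lborel)
        \<le> (\<integral>\<^sup>+u. 2 * (?L (dilate_fst u c\<^sub>2 m) x * indicator ?I1 u)
          + 2 * (D * ((\<integral>\<^sup>+v. ?L (dilate_fst_snd u v m) x * indicator ?I2 v \<partial>lborel) * indicator ?I1 u)) \<partial>lborel)"
      by (intro nn_integral_mono) (use inc3 in \<open>auto simp: indicator_def\<close>)
    also have "\<dots> = 2 * S1 x + 2 * (D * S12 x)"
      unfolding S1_def S12_def by (simp add: nn_integral_add nn_integral_cmult)
    finally have inc4: "(\<integral>\<^sup>+u. ?L (dilate_fst u t\<^sub>2 m) x * indicator ?I1 u \<partial>lborel) \<le> 2 * S1 x + 2 * (D * S12 x)" .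
    have "?L (dilate t\<^sub>1 t\<^sub>2 m) x \<le> 2 * (2 * S0 x + 2 * (D * S2 x)) + 2 * (D * (2 * S1 x + 2 * (D * S12 x)))"
      by (rule order.trans[OF inc1]) (intro add_mono mult_left_mono inc2 inc4; simp)
    also have "\<dots> = S x"
      unfolding S_def by (simp add: algebra_simps)
    finally show "?L (dilate t\<^sub>1 t\<^sub>2 m) x \<le> S x" .
  next
    have ms1: "(\<lambda>(x, u). ?L (dilate_fst u c\<^sub>2 m) x) \<in> borel_measurable (lborel \<Otimes>\<^sub>M lborel)"
      by measurable
    have ms2: "(\<lambda>(x, v). ?L (dilate_snd c\<^sub>1 v m) x) \<in> borel_measurable (lborel \<Otimes>\<^sub>M lborel)"
      by measurable
    have ms3: "(\<lambda>(x, u). \<integral>\<^sup>+v. ?L (dilate_fst_snd u v m) x * indicator ?I2 v \<partial>lborel)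
        \<in> borel_measurable (lborel \<Otimes>\<^sub>M lborel)"
      by measurable
    have ms4: "(\<lambda>(x, v). ?L (dilate_fst_snd u v m) x) \<in> borel_measurable (lborel \<Otimes>\<^sub>M lborel)" for u
      by measurable
    have i0: "(\<integral>\<^sup>+x. S0 x \<partial>lborel) \<le> 2 * (ennreal (W\<^sup>2) * ?E)"
      unfolding S0_def using c by (intro L2 n_meas c0 b0)
    have i1: "(\<integral>\<^sup>+x. S1 x \<partial>lborel) \<le> D * (2 * (ennreal ((?d * M * W)\<^sup>2) * ?E))"
      unfolding S1_def D_def using c \<delta> by (intro nn_integral_average_le ms1 L2 n_meas[OF c1] b1) auto
    have i2: "(\<integral>\<^sup>+x. S2 x \<partial>lborel) \<le> D * (2 * (ennreal ((?d * M * W)\<^sup>2) * ?E))"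
      unfolding S2_def D_def using c \<delta> by (intro nn_integral_average_le ms2 L2 n_meas[OF c2] b2) auto
    have i12: "(\<integral>\<^sup>+x. S12 x \<partial>lborel) \<le> D * (D * (2 * (ennreal ((?d * M * (?d * M * W))\<^sup>2) * ?E)))"
      unfolding S12_def D_def using c \<delta>
      by (intro nn_integral_average_le ms3 ms4 L2 n_meas[OF c12] b12) auto
    have scale0: "4 * (2 * (ennreal r * P)) = ennreal (8 * r) * P" if "r \<ge> 0" for r P
      using that by (simp add: ennreal_mult mult.assoc[symmetric])
    have scale: "4 * (D * (D * (2 * (ennreal r * P)))) = ennreal (8 * (\<delta> * \<delta> * r)) * P"
      if "r \<ge> 0" for r P
    proof -
      have "4 * (D * (D * (2 * (ennreal r * P)))) = 4 * (2 * (D * D * ennreal r * P))"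
        by (simp only: mult_ac)
      also have "D * D * ennreal r = ennreal (\<delta> * \<delta> * r)"
        using \<delta> that by (simp add: D_def ennreal_mult)
      also have "4 * (2 * (ennreal (\<delta> * \<delta> * r) * P)) = ennreal (8 * (\<delta> * \<delta> * r)) * P"
        using \<delta> that by (intro scale0) simp
      finally show ?thesis .
    qed
    have scale2: "4 * (D * (D * (D * (D * (2 * (ennreal r * P)))))) = ennreal (8 * (\<delta> * \<delta> * (\<delta> * \<delta> * r))) * P"
      if "r \<ge> 0" for r P
    proof -
      have "4 * (D * (D * (D * (D * (2 * (ennreal r * P)))))) = 4 * (D * (D * (2 * (D * D * ennreal r * P))))"
        by (simp only: mult_ac)
      also have "D * D * ennreal r = ennreal (\<delta> * \<delta> * r)"
        using \<delta> that by (simp add: D_def ennreal_mult)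
      also have "4 * (D * (D * (2 * (ennreal (\<delta> * \<delta> * r) * P)))) = ennreal (8 * (\<delta> * \<delta> * (\<delta> * \<delta> * r))) * P"
        using \<delta> that by (intro scale) simp
      finally show ?thesis .
    qed
    have "(\<integral>\<^sup>+x. S x \<partial>lborel) = 4 * (\<integral>\<^sup>+x. S0 x \<partial>lborel) + 4 * (D * (\<integral>\<^sup>+x. S1 x \<partial>lborel))
        + 4 * (D * (\<integral>\<^sup>+x. S2 x \<partial>lborel)) + 4 * (D * (D * (\<integral>\<^sup>+x. S12 x \<partial>lborel)))"
      unfolding S_def by (simp add: nn_integral_add nn_integral_cmult)
    also have "\<dots> \<le> 4 * (2 * (ennreal (W\<^sup>2) * ?E)) + 4 * (D * (D * (2 * (ennreal ((?d * M * W)\<^sup>2) * ?E))))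
        + 4 * (D * (D * (2 * (ennreal ((?d * M * W)\<^sup>2) * ?E))))
        + 4 * (D * (D * (D * (D * (2 * (ennreal ((?d * M * (?d * M * W))\<^sup>2) * ?E))))))"
      by (intro add_mono mult_left_mono i0 i1 i2 i12) auto
    also have "\<dots> = (ennreal (8 * W\<^sup>2) + ennreal (8 * (\<delta> * \<delta> * (?d * M * W)\<^sup>2))
        + ennreal (8 * (\<delta> * \<delta> * (?d * M * W)\<^sup>2))
        + ennreal (8 * (\<delta> * \<delta> * (\<delta> * \<delta> * (?d * M * (?d * M * W))\<^sup>2)))) * ?E"
      by (simp only: scale0 scale scale2 zero_le_power2 distrib_right)
    also have "ennreal (8 * W\<^sup>2) + ennreal (8 * (\<delta> * \<delta> * (?d * M * W)\<^sup>2))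
        + ennreal (8 * (\<delta> * \<delta> * (?d * M * W)\<^sup>2))
        + ennreal (8 * (\<delta> * \<delta> * (\<delta> * \<delta> * (?d * M * (?d * M * W))\<^sup>2)))
        = ennreal (8 * W\<^sup>2 * (1 + (\<delta> * ?d * M)\<^sup>2)\<^sup>2)"
    proof -
      have "8 * W\<^sup>2 + 8 * (\<delta> * \<delta> * (?d * M * W)\<^sup>2) + 8 * (\<delta> * \<delta> * (?d * M * W)\<^sup>2)
          + 8 * (\<delta> * \<delta> * (\<delta> * \<delta> * (?d * M * (?d * M * W))\<^sup>2)) = 8 * W\<^sup>2 * (1 + (\<delta> * ?d * M)\<^sup>2)\<^sup>2"
        by algebra
      then show ?thesis
        using \<delta> by (subst ennreal_plus[symmetric], simp, simp)+ simp
    qed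
    finally show "(\<integral>\<^sup>+x. S x \<partial>lborel) \<le> ennreal (8 * W\<^sup>2 * (1 + (\<delta> * ?d * M)\<^sup>2)\<^sup>2) * ?E" .
  qed
qed

section \<open>Coverings and norms\<close>

lemma ennreal_power2_le_imp_le:
  fixes x y :: ennreal
  assumes "x\<^sup>2 \<le> y\<^sup>2"
  shows "x \<le> y"
proof (cases "y = \<top>")
  case False
  then have "y\<^sup>2 \<noteq> \<top>" by (simp add: power2_eq_square ennreal_mult_eq_top_iff)
  with assms have "x \<noteq> \<top>" by (auto simp: power2_eq_square ennreal_mult_eq_top_iff top_unique)
  with False obtain a b where ab: "x = ennreal a" "0 \<le> a" "y = ennreal b" "0 \<le> b"
    by (cases x rule: ennreal_cases; cases y rule: ennreal_cases) auto
  with assms have "a\<^sup>2 \<le> b\<^sup>2" by (simp add: ennreal_power)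
  with ab show ?thesis by (auto intro: ennreal_leI power2_le_imp_le)
qed simp

lemma ennreal_ex_sqrt: "\<exists>r::ennreal. r\<^sup>2 = R"
proof (cases R rule: ennreal_cases)
  case (real b)
  then have "(ennreal (sqrt b))\<^sup>2 = R" by (simp add: ennreal_power)
  then show ?thesis ..
next
  case top
  then have "\<top>\<^sup>2 = R" by (simp add: power2_eq_square)
  then show ?thesis ..
qed

lemma SUP_power2_le:
  fixes f :: "'i \<Rightarrow> ennreal"
  assumes "\<And>i. i \<in> I \<Longrightarrow> (f i)\<^sup>2 \<le> R"
  shows "(SUP i\<in>I. f i)\<^sup>2 \<le> R"
proof -
  obtain r :: ennreal where r: "r\<^sup>2 = R" using ennreal_ex_sqrt by blast
  have "(SUP i\<in>I. f i) \<le> r"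
    by (rule SUP_least, rule ennreal_power2_le_imp_le) (simp only: r assms)
  then have "(SUP i\<in>I. f i)\<^sup>2 \<le> r\<^sup>2" by (rule power_mono) simp
  then show ?thesis by (simp only: r)
qed

text \<open>Valid also when the integral is infinite, so the whole estimate can be carried out on
  squares and the root extracted once at the end.\<close>

lemma L2_enorm_power2: "(L2_enorm F)\<^sup>2 = (\<integral>\<^sup>+x. (F x)\<^sup>2 \<partial>lborel)"
proof (cases "(\<integral>\<^sup>+x. (F x)\<^sup>2 \<partial>lborel)" rule: ennreal_cases)
  case (real b)
  then show ?thesis by (simp add: L2_enorm_def ennreal_power)
next
  case top
  then show ?thesis by (simp add: L2_enorm_def power2_eq_square)
qed

text \<open>Cauchy-Schwarz for counting measure after writing a_j as q^(j/2) times q^(-j/2) a_j. It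
  stands in for Minkowski's inequality over the shells: being pointwise in x, it can be applied
  before the supremum and before the integral. The price is the weight q^(-j), affordable because
  the squared shell bounds decay geometrically.\<close>

lemma suminf_power2_le:
  fixes a :: "nat \<Rightarrow> ennreal"
  assumes q: "0 < q" "q < 1"
  shows "(\<Sum>j. a j)\<^sup>2 \<le> ennreal (1 / (1 - q)) * (\<Sum>j. ennreal ((1 / q) ^ j) * (a j)\<^sup>2)"
proof -
  let ?r = "sqrt q"
  have r: "0 < ?r" using q by simp
  have split: "ennreal (?r ^ j) * (ennreal ((1 / ?r) ^ j) * a j) = a j" for j
    using r by (simp add: mult.assoc[symmetric] ennreal_mult[symmetric] power_mult_distrib[symmetric])
  have sq: "(ennreal (?r ^ j))\<^sup>2 = ennreal (q ^ j)" "(ennreal ((1 / ?r) ^ j))\<^sup>2 = ennreal ((1 / q) ^ j)" for j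
    using q by (simp_all add: ennreal_power power_even_eq[symmetric] power_mult[symmetric] mult.commute
        power_divide real_sqrt_power_even)
  have "(\<Sum>j. a j)\<^sup>2 = (\<integral>\<^sup>+j. ennreal (?r ^ j) * (ennreal ((1 / ?r) ^ j) * a j) \<partial>count_space UNIV)\<^sup>2"
    by (simp add: split nn_integral_count_space_nat)
  also have "\<dots> \<le> (\<integral>\<^sup>+j. (ennreal (?r ^ j))\<^sup>2 \<partial>count_space UNIV)
      * (\<integral>\<^sup>+j. (ennreal ((1 / ?r) ^ j) * a j)\<^sup>2 \<partial>count_space UNIV)"
    by (rule Cauchy_Schwarz_nn_integral) auto
  also have "\<dots> = (\<Sum>j. ennreal (q ^ j)) * (\<Sum>j. ennreal ((1 / q) ^ j) * (a j)\<^sup>2)"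
    by (simp add: nn_integral_count_space_nat power_mult_distrib sq)
  also have "(\<Sum>j. ennreal (q ^ j)) = ennreal (1 / (1 - q))"
    using q by (subst suminf_ennreal2) (auto simp: summable_geometric suminf_geometric)
  finally show ?thesis .
qed

text \<open>Countable additivity when f is integrable and the series finite. Otherwise the left-hand
  side is 0 by convention or the right-hand side is infinite.\<close>

lemma norm_integral_le_suminf:
  fixes f :: "'b \<Rightarrow> complex" and A :: "nat \<Rightarrow> 'b set"
  assumes A: "\<And>j. A j \<in> sets M" "disjoint_family A" "(\<Union>j. A j) = space M"
  shows "ennreal (cmod (integral\<^sup>L M f)) \<le> (\<Sum>j. ennreal (cmod (LINT z|M. indicator (A j) z * f z)))"
proof (cases "integrable M f \<and> (\<Sum>j. ennreal (cmod (LINT z|M. indicator (A j) z * f z))) \<noteq> \<top>")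
  case True
  let ?I = "\<lambda>j. LINT z|M. indicator (A j) z * f z"
  have s: "summable (\<lambda>j. cmod (?I j))"
    using True by (intro summable_suminf_not_top) auto
  have "integral\<^sup>L M f = (LINT z:(\<Union>j. A j)|M. f z)"
    unfolding A(3) set_lebesgue_integral_def by (intro Bochner_Integration.integral_cong) auto
  also have "\<dots> = (\<Sum>j. LINT z:A j|M. f z)"
  proof (rule lebesgue_integral_countable_add)
    show "A i \<inter> A j = {}" if "i \<noteq> j" for i j
      using A(2) that by (auto simp: disjoint_family_on_def)
    show "set_integrable M (\<Union>j. A j) f"
      unfolding A(3) set_integrable_def using True
      by (subst Bochner_Integration.integrable_cong[OF refl, of _ _ f]) auto
  qed (rule A)
  also have "\<dots> = (\<Sum>j. ?I j)"
    unfolding set_lebesgue_integral_def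
    by (intro suminf_cong Bochner_Integration.integral_cong) (auto simp: indicator_def)
  finally have "cmod (integral\<^sup>L M f) \<le> (\<Sum>j. cmod (?I j))"
    using summable_norm[OF s] by simp
  then show ?thesis
    using s by (subst suminf_ennreal2) (auto intro: ennreal_leI)
qed (auto simp: not_integrable_integral_eq)

lemma dyadic_covering:
  assumes E: "E \<subseteq> {1..2}"
  obtains A where "finite A" "A \<subseteq> {1..2::real}" "card A \<le> covering_number E ((1/2) ^ j)"
    "E \<subseteq> (\<Union>c\<in>A. {c..c + (1/2) ^ j})"
proof -
  let ?\<delta> = "(1/2) ^ j :: real"
  let ?P = "\<lambda>n. \<exists>A. finite A \<and> card A = n \<and> E \<subseteq> (\<Union>c\<in>A. {c..c + ?\<delta>})"
  \<comment> \<open>The uniform grid shows that some finite covering exists, so that the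
    \<open>LEAST\<close> in \<open>covering_number\<close> is attained.\<close>
  have "E \<subseteq> (\<Union>c\<in>(\<lambda>k. 1 + real k * ?\<delta>) ` {..2 ^ j}. {c..c + ?\<delta>})"
  proof
    fix t assume "t \<in> E"
    with E have t: "1 \<le> t" "t \<le> 2" by auto
    define k where "k = nat \<lfloor>(t - 1) / ?\<delta>\<rfloor>"
    have k: "real k \<le> (t - 1) / ?\<delta>" "(t - 1) / ?\<delta> < real k + 1"
      unfolding k_def using t by auto
    have "(t - 1) / ?\<delta> \<le> 1 / ?\<delta>" using t by (intro divide_right_mono) auto
    also have "1 / ?\<delta> = 2 ^ j" by (simp add: power_one_over)
    finally have "k \<le> 2 ^ j" using k(1) by (metis of_nat_le_iff of_nat_numeral of_nat_power order_trans)
    moreover have "t \<in> {1 + real k * ?\<delta>..1 + real k * ?\<delta> + ?\<delta>}"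
      using k by (simp add: pos_le_divide_eq pos_divide_less_eq algebra_simps)
    ultimately show "t \<in> (\<Union>c\<in>(\<lambda>k. 1 + real k * ?\<delta>) ` {..2 ^ j}. {c..c + ?\<delta>})" by blast
  qed
  then have "?P (card ((\<lambda>k. 1 + real k * ?\<delta>) ` {..2 ^ j}))" by blast
  then have "?P (covering_number E ?\<delta>)"
    unfolding covering_number_def by (rule LeastI)
  then obtain A where A: "finite A" "card A = covering_number E ?\<delta>" "E \<subseteq> (\<Union>c\<in>A. {c..c + ?\<delta>})"
    by blast
  let ?h = "\<lambda>c. max 1 (min c 2) :: real"
  show thesis
  proof (rule that[of "?h ` A"])
    show "E \<subseteq> (\<Union>c\<in>?h ` A. {c..c + ?\<delta>})"
    proof
      fix t assume t: "t \<in> E"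
      with A obtain c where "c \<in> A" "t \<in> {c..c + ?\<delta>}" by blast
      moreover have "1 \<le> t" "t \<le> 2" using t E by auto
      moreover have "0 < ?\<delta>" by simp
      ultimately have "?h c \<in> ?h ` A \<and> t \<in> {?h c..?h c + ?\<delta>}"
        by (auto simp: max_def min_def)
      then show "t \<in> (\<Union>c\<in>?h ` A. {c..c + ?\<delta>})" by blast
    qed
    show "card (?h ` A) \<le> covering_number E ?\<delta>"
      using card_image_le[OF A(1)] A(2) by simp
  qed (use A in auto)
qed

text \<open>An upper limit below \<beta> + \<epsilon> bounds all sufficiently small scales; only the
  dyadic ones are kept, and the finitely many coarse ones are absorbed into C.\<close>

lemma covering_number_growth:
  assumes dim: "upper_minkowski_dim E = ereal \<beta>" and "\<epsilon> > 0"
  obtains C where "C > 0" "\<And>j. real (covering_number E ((1/2) ^ j)) \<le> C * 2 powr (real j * (\<beta> + \<epsilon>))"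
proof -
  let ?N = "\<lambda>j. real (covering_number E ((1/2) ^ j))" and ?p = "\<lambda>j. 2 powr (real j * (\<beta> + \<epsilon>))"
  have "Limsup (at_right 0) (\<lambda>\<delta>. ereal (ln (real (covering_number E \<delta>)) / ln (1 / \<delta>))) < ereal (\<beta> + \<epsilon>)"
    using dim \<open>\<epsilon> > 0\<close> unfolding upper_minkowski_dim_def by simp
  then have ev: "eventually (\<lambda>\<delta>. ereal (ln (real (covering_number E \<delta>)) / ln (1 / \<delta>)) < ereal (\<beta> + \<epsilon>)) (at_right 0)"
    by (rule Limsup_lessD)
  have "filterlim (\<lambda>j. (1/2) ^ j :: real) (at_right 0) sequentially"
    by (intro tendsto_imp_filterlim_at_right LIMSEQ_realpow_zero always_eventually) auto
  from eventually_compose_filterlim[OF ev this] obtain J where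
    J: "\<And>j. j \<ge> J \<Longrightarrow> ln (?N j) / ln (1 / (1/2) ^ j) < \<beta> + \<epsilon>"
    unfolding eventually_sequentially by auto
  \<comment> \<open>At j = 0 the denominator ln 1 is zero and the quotient carries no information,
    hence the restriction j \<ge> 1.\<close>
  have big: "?N j \<le> ?p j" if "j \<ge> J" "j \<ge> 1" for j
  proof (cases "?N j = 0")
    case False
    have l: "ln (1 / (1/2) ^ j) = real j * ln 2"
      by (simp add: power_one_over ln_realpow)
    have "0 < real j * ln 2" using that by simp
    then have "ln (?N j) < real j * ln 2 * (\<beta> + \<epsilon>)"
      using J[OF that(1)] unfolding l by (simp add: pos_divide_less_eq mult.commute)
    moreover have "?N j = exp (ln (?N j))" using False by simp
    ultimately have "?N j \<le> exp (real j * ln 2 * (\<beta> + \<epsilon>))"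
      by (metis exp_le_cancel_iff less_imp_le)
    then show ?thesis by (simp add: powr_def mult_ac)
  qed simp
  \<comment> \<open>The summand 1 serves the scales beyond J, where j \<ge> 1 holds as well; the sum
    serves those up to J.\<close>
  define C where "C = 1 + (\<Sum>j\<le>J. ?N j / ?p j)"
  have nn: "0 \<le> (\<Sum>j\<in>S. ?N j / ?p j)" for S by (intro sum_nonneg) auto
  show thesis
  proof (rule that[of C])
    show "C > 0" unfolding C_def using nn[of "{..J}"] by simp
    show "?N j \<le> C * ?p j" for j
    proof (cases "j \<le> J")
      case True
      then have "?N j / ?p j \<le> (\<Sum>j\<le>J. ?N j / ?p j)"
        by (intro member_le_sum) auto
      then have "?N j / ?p j \<le> C" unfolding C_def by simp
      then show ?thesis by (simp add: pos_divide_le_eq)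
    next
      case False
      then have "?N j \<le> 1 * ?p j" using big[of j] by simp
      also have "\<dots> \<le> C * ?p j"
        unfolding C_def using nn[of "{..J}"] by (intro mult_right_mono) auto
      finally show ?thesis .
    qed
  qed
qed

text \<open>On the ball of radius 2^j one has 1 + |\<xi>|^2 \<le> 2 * 4^j, so removing the Sobolev
  weight costs at most this quantity to the power s. This is the growth 2^(2 s j) that the decay of
  the multiplier must absorb.\<close>

lemma local_energy_le_sobolev:
  assumes "s \<ge> 0" and [measurable]: "fourier f \<in> borel_measurable borel"
  shows "local_energy (fourier f) (2 ^ j) \<le> ennreal ((2 * 4 ^ j) powr s) * (sobolev_neg_norm s f)\<^sup>2"
proof -
  let ?w = "\<lambda>\<xi>. (1 + (norm \<xi>)\<^sup>2) powr (- s / 2) * cmod (fourier f \<xi>)"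
  have "local_energy (fourier f) (2 ^ j) \<le> (\<integral>\<^sup>+\<xi>. ennreal ((2 * 4 ^ j) powr s) * (ennreal (?w \<xi>))\<^sup>2 \<partial>lborel)"
    unfolding local_energy_def
  proof (intro nn_integral_mono)
    fix \<xi> :: 'a
    show "ennreal ((cmod (fourier f \<xi>))\<^sup>2) * indicator (cball 0 (2 ^ j)) \<xi>
        \<le> ennreal ((2 * 4 ^ j) powr s) * (ennreal (?w \<xi>))\<^sup>2"
    proof (cases "norm \<xi> \<le> 2 ^ j")
      case True
      then have "(norm \<xi>)\<^sup>2 \<le> (2 ^ j)\<^sup>2" by (intro power_mono) auto
      also have "(2 ^ j)\<^sup>2 = (4 ^ j :: real)" by (simp add: power2_eq_square flip: power_mult_distrib)
      finally have "1 + (norm \<xi>)\<^sup>2 \<le> 2 * 4 ^ j"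
        using one_le_power[of "4 :: real" j] by linarith
      then have le: "(1 + (norm \<xi>)\<^sup>2) powr s \<le> (2 * 4 ^ j) powr s"
        using \<open>s \<ge> 0\<close> by (intro powr_mono2) auto
      have pos: "0 < 1 + (norm \<xi>)\<^sup>2" by (simp add: add_pos_nonneg)
      have "(?w \<xi>)\<^sup>2 = (1 + (norm \<xi>)\<^sup>2) powr (- s) * (cmod (fourier f \<xi>))\<^sup>2"
        by (simp add: power_mult_distrib power2_eq_square flip: powr_add)
      then have "(cmod (fourier f \<xi>))\<^sup>2 = (1 + (norm \<xi>)\<^sup>2) powr s * (?w \<xi>)\<^sup>2"
        using pos by (simp add: mult.assoc[symmetric] flip: powr_add)
      also have "\<dots> \<le> (2 * 4 ^ j) powr s * (?w \<xi>)\<^sup>2"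
        using le by (intro mult_right_mono) auto
      finally have "ennreal ((cmod (fourier f \<xi>))\<^sup>2) \<le> ennreal ((2 * 4 ^ j) powr s) * (ennreal (?w \<xi>))\<^sup>2"
        by (simp add: ennreal_power ennreal_leI flip: ennreal_mult)
      then show ?thesis by (auto simp: indicator_def)
    qed simp
  qed
  also have "\<dots> = ennreal ((2 * 4 ^ j) powr s) * (sobolev_neg_norm s f)\<^sup>2"
    unfolding sobolev_neg_norm_def L2_enorm_power2 by (intro nn_integral_cmult) measurable
  finally show ?thesis .
qed

lemma fourier_test_function:
  assumes "f \<in> test_functions"
  shows "fourier f \<in> borel_measurable borel" and "cmod (fourier f \<xi>) \<le> (LINT x|lborel. cmod (f x))"
proof -
  have "continuous_on UNIV f"
    using assms C_k.simps(1)[of f] unfolding test_functions_def by blast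
  then have [measurable]: "f \<in> borel_measurable borel"
    by (rule borel_measurable_continuous_onI)
  show "fourier f \<in> borel_measurable borel"
    unfolding fourier_def by measurable
  have "cmod (fourier f \<xi>) \<le> (LINT x|lborel. cmod (f x * exp (- 2 * complex_of_real pi * \<i> * complex_of_real (x \<bullet> \<xi>))))"
    unfolding fourier_def by (rule integral_norm_bound)
  also have "\<dots> = (LINT x|lborel. cmod (f x))"
    by (simp add: norm_mult)
  finally show "cmod (fourier f \<xi>) \<le> (LINT x|lborel. cmod (f x))" .
qed

text \<open>Admissibility gives a constant for each derivative separately; only finitely many lists
  over the basis have length at most k, and the sum of the absolute constants serves them
  all.\<close>

lemma admissible_uniform_decay:
  fixes m :: "'a::euclidean_space \<times> 'a \<Rightarrow> complex"
  assumes "admissible a k m"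
  obtains C where "C \<ge> 0" "\<And>bs z. set bs \<subseteq> Basis \<Longrightarrow> length bs \<le> k \<Longrightarrow>
    cmod (iterated_partial bs m z) \<le> C * (1 + norm (fst z) + norm (snd z)) powr (- a)"
proof -
  let ?L = "{bs :: ('a \<times> 'a) list. set bs \<subseteq> Basis \<and> length bs \<le> k}"
  have fin: "finite ?L" by (rule finite_lists_length_le) simp
  obtain C where C: "\<And>bs \<xi> \<eta>. bs \<in> ?L \<Longrightarrow>
      cmod (iterated_partial bs m (\<xi>, \<eta>)) \<le> C bs * (1 + norm \<xi> + norm \<eta>) powr (- a)"
    using assms unfolding admissible_def by (auto dest!: choice) metis
  show thesis
  proof (rule that[of "\<Sum>bs\<in>?L. \<bar>C bs\<bar>"])
    fix bs :: "('a \<times> 'a) list" and z :: "'a \<times> 'a" assume "set bs \<subseteq> Basis" "length bs \<le> k"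
    then have bs: "bs \<in> ?L" by simp
    have "C bs \<le> \<bar>C bs\<bar>" by simp
    also have "\<dots> \<le> (\<Sum>bs\<in>?L. \<bar>C bs\<bar>)" using fin bs by (intro member_le_sum) auto
    finally have "C bs * (1 + norm (fst z) + norm (snd z)) powr (- a)
        \<le> (\<Sum>bs\<in>?L. \<bar>C bs\<bar>) * (1 + norm (fst z) + norm (snd z)) powr (- a)"
      by (rule mult_right_mono) simp
    with C[OF bs, of "fst z" "snd z"]
    show "cmod (iterated_partial bs m z) \<le> (\<Sum>bs\<in>?L. \<bar>C bs\<bar>) * (1 + norm (fst z) + norm (snd z)) powr (- a)"
      by simp
  qed (simp add: sum_nonneg)
qed

section \<open>Summation over the frequency shells\<close>

text \<open>The cut-off is sharp and acts on the undilated frequencies, hence does not depend on the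
  dilation parameters; since these lie in \<open>[1, 3]\<close>, the multiplier still has its dyadic size on
  each shell.\<close>

definition frequency_box :: "nat \<Rightarrow> ('a::euclidean_space \<times> 'a) set" where
  "frequency_box j = {z. norm (fst z) + norm (snd z) \<le> 2 ^ j}"

text \<open>The boxes increase, so for j \<ge> 1 this is the region where the sum of the norms lies
  in (2^(j-1), 2^j], while the shell of index 0 is the full box of size 1.\<close>

definition frequency_shell :: "nat \<Rightarrow> ('a::euclidean_space \<times> 'a) set" where
  "frequency_shell = disjointed frequency_box"

lemma sets_frequency_shell [measurable]: "frequency_shell j \<in> sets borel"
proof -
  have "closed (frequency_box i :: ('a \<times> 'a) set)" for i
    unfolding frequency_box_def by (intro closed_Collect_le continuous_intros)
  then have "range (frequency_box :: nat \<Rightarrow> ('a \<times> 'a) set) \<subseteq> sets borel"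
    by (auto intro: borel_closed)
  then have "range (disjointed (frequency_box :: nat \<Rightarrow> ('a \<times> 'a) set)) \<subseteq> sets borel"
    by (rule sets.range_disjointed_sets)
  then show ?thesis unfolding frequency_shell_def by blast
qed

lemma UN_frequency_shell: "(\<Union>j. frequency_shell j) = (UNIV :: ('a::euclidean_space \<times> 'a) set)"
proof -
  have "\<exists>j. norm (fst z) + norm (snd z) \<le> 2 ^ j" for z :: "'a \<times> 'a"
    using real_arch_pow[of 2 "norm (fst z) + norm (snd z)"] less_imp_le by auto
  then show ?thesis
    unfolding frequency_shell_def UN_disjointed_eq by (auto simp: frequency_box_def)
qed

lemma frequency_shell_subset: "frequency_shell j \<subseteq> cball 0 (2 ^ j) \<times> cball 0 (2 ^ j)"
proof
  fix z :: "'a \<times> 'a" assume "z \<in> frequency_shell j"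
  then have "norm (fst z) + norm (snd z) \<le> 2 ^ j"
    using disjointed_subset[of frequency_box j] unfolding frequency_shell_def frequency_box_def by auto
  then have "norm (fst z) \<le> 2 ^ j" "norm (snd z) \<le> 2 ^ j"
    using norm_ge_zero[of "fst z"] norm_ge_zero[of "snd z"] by linarith+
  then show "z \<in> cball 0 (2 ^ j) \<times> cball 0 (2 ^ j)" by (cases z) auto
qed

text \<open>The summand 1 makes the bound hold on the lowest shell too, which contains the
  origin.\<close>

lemma frequency_shell_lower_bound:
  assumes "z \<in> frequency_shell j"
  shows "2 ^ j / 2 \<le> 1 + norm (fst z) + norm (snd z)"
proof (cases j)
  case 0
  have "0 \<le> norm (fst z) + norm (snd z)" by simp
  with 0 show ?thesis by simp
next
  case (Suc i)
  then have "z \<notin> frequency_box i"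
    using assms unfolding frequency_shell_def disjointed_def by auto
  with Suc show ?thesis by (simp add: frequency_box_def)
qed

lemma bilinear_operator_le_shells:
  fixes f g :: "'a::euclidean_space \<Rightarrow> complex"
  shows "ennreal (cmod (bilinear_operator n f g x))
    \<le> (\<Sum>j. ennreal (cmod (localized_bilinear (frequency_shell j) (fourier f) (fourier g) n x)))"
proof -
  let ?\<Phi> = "\<lambda>z. fourier f (fst z) * fourier g (snd z) * n z * wave (x \<bullet> (fst z + snd z))"
  have op: "bilinear_operator n f g x = (LINT z|lborel. ?\<Phi> z)"
    unfolding bilinear_operator_def wave_def by (simp add: case_prod_beta')
  have shell: "localized_bilinear (frequency_shell j) (fourier f) (fourier g) n x
      = (LINT z|lborel. indicator (frequency_shell j) z * ?\<Phi> z)" for j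
    unfolding localized_bilinear_def by (simp add: mult_ac)
  have "disjoint_family (frequency_shell :: nat \<Rightarrow> ('a \<times> 'a) set)"
    unfolding frequency_shell_def by (rule disjoint_family_disjointed)
  then show ?thesis
    unfolding op shell by (intro norm_integral_le_suminf) (simp_all add: UN_frequency_shell)
qed

text \<open>Every pair of parameters lies in one of the products of covering intervals, so a sum of
  the local majorants over these products dominates the square for all parameters at once. Summing
  nonnegative majorants over the products yields the two covering numbers as factors.\<close>

lemma shell_maximal_bound:
  fixes m :: "'a::euclidean_space \<times> 'a \<Rightarrow> complex" and F G :: "'a \<Rightarrow> complex"
  assumes m: "C_k 2 m" and "a \<ge> 0" "C\<^sub>0 \<ge> 0"
    and decay: "\<And>bs z. set bs \<subseteq> Basis \<Longrightarrow> length bs \<le> 2 \<Longrightarrow>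
        cmod (iterated_partial bs m z) \<le> C\<^sub>0 * (1 + norm (fst z) + norm (snd z)) powr (- a)"
    and E: "E\<^sub>1 \<subseteq> {1..2}" "E\<^sub>2 \<subseteq> {1..2}"
    and meas: "F \<in> borel_measurable borel" "G \<in> borel_measurable borel"
    and F: "\<And>\<xi>. cmod (F \<xi>) \<le> CF" and G: "\<And>\<eta>. cmod (G \<eta>) \<le> CG"
  shows "\<exists>S. S \<in> borel_measurable (borel :: 'a measure)
    \<and> (\<forall>t\<^sub>1\<in>E\<^sub>1. \<forall>t\<^sub>2\<in>E\<^sub>2. \<forall>x. (ennreal (cmod (localized_bilinear (frequency_shell j) F G (dilate t\<^sub>1 t\<^sub>2 m) x)))\<^sup>2 \<le> S x)
    \<and> (\<integral>\<^sup>+x. S x \<partial>lborel) \<le> ennreal (real (covering_number E\<^sub>1 ((1/2) ^ j)) * real (covering_number E\<^sub>2 ((1/2) ^ j))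
        * (8 * (C\<^sub>0 * (2 ^ j / 2) powr (- a))\<^sup>2 * (1 + (real DIM('a))\<^sup>2)\<^sup>2))
        * (emeasure lborel (cball 0 (2 ^ j) :: 'a set) * local_energy F (2 ^ j) * local_energy G (2 ^ j))"
proof -
  let ?W = "C\<^sub>0 * (2 ^ j / 2) powr (- a)" and ?\<delta> = "(1/2) ^ j :: real"
  let ?A = "frequency_shell j :: ('a \<times> 'a) set"
  let ?K = "8 * ?W\<^sup>2 * (1 + (real DIM('a))\<^sup>2)\<^sup>2"
  let ?E = "emeasure lborel (cball 0 (2 ^ j) :: 'a set) * local_energy F (2 ^ j) * local_energy G (2 ^ j)"
  have W: "cmod (dilate t\<^sub>1 t\<^sub>2 (iterated_partial bs m) z) \<le> ?W"
    if "set bs \<subseteq> Basis" "length bs \<le> 2" "t\<^sub>1 \<ge> 1" "t\<^sub>2 \<ge> 1" "z \<in> ?A" for bs t\<^sub>1 t\<^sub>2 z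
  proof -
    have dil: "dilate t\<^sub>1 t\<^sub>2 (iterated_partial bs m) z = iterated_partial bs m (t\<^sub>1 *\<^sub>R fst z, t\<^sub>2 *\<^sub>R snd z)"
      by (cases z) (simp add: dilate_def)
    have "1 * norm (fst z) \<le> t\<^sub>1 * norm (fst z)" "1 * norm (snd z) \<le> t\<^sub>2 * norm (snd z)"
      using that by (intro mult_right_mono; simp)+
    then have "2 ^ j / 2 \<le> 1 + norm (t\<^sub>1 *\<^sub>R fst z) + norm (t\<^sub>2 *\<^sub>R snd z)"
      using frequency_shell_lower_bound[OF that(5)] that(3,4) by simp
    then have "(1 + norm (t\<^sub>1 *\<^sub>R fst z) + norm (t\<^sub>2 *\<^sub>R snd z)) powr (- a) \<le> (2 ^ j / 2) powr (- a)"
      using \<open>a \<ge> 0\<close> by (intro powr_mono2') auto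
    then have "C\<^sub>0 * (1 + norm (t\<^sub>1 *\<^sub>R fst z) + norm (t\<^sub>2 *\<^sub>R snd z)) powr (- a) \<le> ?W"
      using \<open>C\<^sub>0 \<ge> 0\<close> by (rule mult_left_mono)
    with decay[OF that(1,2), of "(t\<^sub>1 *\<^sub>R fst z, t\<^sub>2 *\<^sub>R snd z)"] show ?thesis
      unfolding dil by simp
  qed
  have "\<exists>S. S \<in> borel_measurable (borel :: 'a measure)
      \<and> (\<forall>t\<^sub>1\<in>{c\<^sub>1..c\<^sub>1 + ?\<delta>}. \<forall>t\<^sub>2\<in>{c\<^sub>2..c\<^sub>2 + ?\<delta>}. \<forall>x.
          (ennreal (cmod (localized_bilinear ?A F G (dilate t\<^sub>1 t\<^sub>2 m) x)))\<^sup>2 \<le> S x)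
      \<and> (\<integral>\<^sup>+x. S x \<partial>lborel) \<le> ennreal ?K * ?E" if c: "c\<^sub>1 \<ge> 1" "c\<^sub>2 \<ge> 1" for c\<^sub>1 c\<^sub>2
  proof -
    have \<delta>0: "?\<delta> \<ge> 0" by simp
    \<comment> \<open>The balance of scales: interval length 2^(-j) against frequency radius 2^j
      makes the derivative factor depend on the dimension only, not on j.\<close>
    have \<delta>M: "?\<delta> * real DIM('a) * 2 ^ j = real DIM('a)" by (simp add: power_one_over)
    obtain S where "S \<in> borel_measurable (borel :: 'a measure)"
      "\<And>t\<^sub>1 t\<^sub>2 x. t\<^sub>1 \<in> {c\<^sub>1..c\<^sub>1 + ?\<delta>} \<Longrightarrow> t\<^sub>2 \<in> {c\<^sub>2..c\<^sub>2 + ?\<delta>} \<Longrightarrow>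
        (ennreal (cmod (localized_bilinear ?A F G (dilate t\<^sub>1 t\<^sub>2 m) x)))\<^sup>2 \<le> S x"
      "(\<integral>\<^sup>+x. S x \<partial>lborel) \<le> ennreal (8 * ?W\<^sup>2 * (1 + (?\<delta> * real DIM('a) * 2 ^ j)\<^sup>2)\<^sup>2) * ?E"
      using square_maximal_bound[OF meas sets_frequency_shell frequency_shell_subset F G m W c \<delta>0]
      by blast
    then show ?thesis unfolding \<delta>M by blast
  qed
  then obtain S where S: "\<And>c\<^sub>1 c\<^sub>2. c\<^sub>1 \<ge> 1 \<Longrightarrow> c\<^sub>2 \<ge> 1 \<Longrightarrow> S c\<^sub>1 c\<^sub>2 \<in> borel_measurable (borel :: 'a measure)"
      "\<And>c\<^sub>1 c\<^sub>2 t\<^sub>1 t\<^sub>2 x. c\<^sub>1 \<ge> 1 \<Longrightarrow> c\<^sub>2 \<ge> 1 \<Longrightarrow> t\<^sub>1 \<in> {c\<^sub>1..c\<^sub>1 + ?\<delta>} \<Longrightarrow> t\<^sub>2 \<in> {c\<^sub>2..c\<^sub>2 + ?\<delta>} \<Longrightarrow>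
        (ennreal (cmod (localized_bilinear ?A F G (dilate t\<^sub>1 t\<^sub>2 m) x)))\<^sup>2 \<le> S c\<^sub>1 c\<^sub>2 x"
      "\<And>c\<^sub>1 c\<^sub>2. c\<^sub>1 \<ge> 1 \<Longrightarrow> c\<^sub>2 \<ge> 1 \<Longrightarrow> (\<integral>\<^sup>+x. S c\<^sub>1 c\<^sub>2 x \<partial>lborel) \<le> ennreal ?K * ?E"
    by metis
  obtain A\<^sub>1 where A1: "finite A\<^sub>1" "A\<^sub>1 \<subseteq> {1..2}" "card A\<^sub>1 \<le> covering_number E\<^sub>1 ?\<delta>" "E\<^sub>1 \<subseteq> (\<Union>c\<in>A\<^sub>1. {c..c + ?\<delta>})"
    using dyadic_covering[OF E(1)] by blast
  obtain A\<^sub>2 where A2: "finite A\<^sub>2" "A\<^sub>2 \<subseteq> {1..2}" "card A\<^sub>2 \<le> covering_number E\<^sub>2 ?\<delta>" "E\<^sub>2 \<subseteq> (\<Union>c\<in>A\<^sub>2. {c..c + ?\<delta>})"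
    using dyadic_covering[OF E(2)] by blast
  have ge: "fst p \<ge> 1" "snd p \<ge> 1" if "p \<in> A\<^sub>1 \<times> A\<^sub>2" for p
    using that A1(2) A2(2) by auto
  let ?T = "\<lambda>x. \<Sum>p\<in>A\<^sub>1 \<times> A\<^sub>2. S (fst p) (snd p) x"
  have Sm [measurable]: "S (fst p) (snd p) \<in> borel_measurable borel" if "p \<in> A\<^sub>1 \<times> A\<^sub>2" for p
    using S(1) ge[OF that] by blast
  show ?thesis
  proof (intro exI[of _ ?T] conjI ballI allI)
    show "?T \<in> borel_measurable borel"
      by (intro borel_measurable_sum Sm)
  next
    fix t\<^sub>1 t\<^sub>2 x assume "t\<^sub>1 \<in> E\<^sub>1" "t\<^sub>2 \<in> E\<^sub>2"
    then obtain c\<^sub>1 c\<^sub>2 where c: "c\<^sub>1 \<in> A\<^sub>1" "t\<^sub>1 \<in> {c\<^sub>1..c\<^sub>1 + ?\<delta>}" "c\<^sub>2 \<in> A\<^sub>2" "t\<^sub>2 \<in> {c\<^sub>2..c\<^sub>2 + ?\<delta>}"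
      using A1(4) A2(4) by blast
    then have p: "(c\<^sub>1, c\<^sub>2) \<in> A\<^sub>1 \<times> A\<^sub>2" by simp
    have "(ennreal (cmod (localized_bilinear ?A F G (dilate t\<^sub>1 t\<^sub>2 m) x)))\<^sup>2 \<le> S c\<^sub>1 c\<^sub>2 x"
      using S(2) ge[OF p] c by simp
    also have "\<dots> = S (fst (c\<^sub>1, c\<^sub>2)) (snd (c\<^sub>1, c\<^sub>2)) x" by simp
    also have "\<dots> \<le> ?T x"
      using A1(1) A2(1) p by (intro member_le_sum) auto
    finally show "(ennreal (cmod (localized_bilinear ?A F G (dilate t\<^sub>1 t\<^sub>2 m) x)))\<^sup>2 \<le> ?T x" .
  next
    have "(\<integral>\<^sup>+x. ?T x \<partial>lborel) = (\<Sum>p\<in>A\<^sub>1 \<times> A\<^sub>2. \<integral>\<^sup>+x. S (fst p) (snd p) x \<partial>lborel)"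
      by (intro nn_integral_sum) (simp add: Sm)
    also have "\<dots> \<le> (\<Sum>p\<in>A\<^sub>1 \<times> A\<^sub>2. ennreal ?K * ?E)"
      by (intro sum_mono S(3) ge)
    also have "\<dots> = ennreal (real (card A\<^sub>1) * real (card A\<^sub>2) * ?K) * ?E"
      by (simp add: card_cartesian_product ennreal_mult ennreal_of_nat_eq_real_of_nat mult.assoc)
    also have "\<dots> \<le> ennreal (real (covering_number E\<^sub>1 ?\<delta>) * real (covering_number E\<^sub>2 ?\<delta>) * ?K) * ?E"
      using A1(3) A2(3) by (intro mult_right_mono ennreal_leI mult_mono) auto
    finally show "(\<integral>\<^sup>+x. ?T x \<partial>lborel)
        \<le> ennreal (real (covering_number E\<^sub>1 ?\<delta>) * real (covering_number E\<^sub>2 ?\<delta>) * ?K) * ?E" .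
  qed
qed

text \<open>Collects the exponents of 2^j: \<open>\<alpha>\<^sub>1\<close> and
  \<open>\<alpha>\<^sub>2\<close> from the coverings, - 2 a from the squared multiplier, d from the
  volume of the ball, \<open>2 * s\<^sub>1\<close> and \<open>2 * s\<^sub>2\<close> from the Sobolev
  weights. Their sum is halved in q, so that the squared norm on a shell decays like q^(2j). The
  constant 2^(2 a) comes from the lower radius 2^j / 2, the other two powers of 2 from the bound 2 *
  4^j.\<close>

lemma dyadic_constants:
  fixes \<alpha>\<^sub>1 \<alpha>\<^sub>2 a s\<^sub>1 s\<^sub>2 :: real and d :: nat
  defines "q \<equiv> 2 powr ((\<alpha>\<^sub>1 + \<alpha>\<^sub>2 - 2 * a + real d + 2 * s\<^sub>1 + 2 * s\<^sub>2) / 2)"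
  shows "(C\<^sub>1 * 2 powr (real j * \<alpha>\<^sub>1)) * (C\<^sub>2 * 2 powr (real j * \<alpha>\<^sub>2)) * (8 * (C\<^sub>0 * (2 ^ j / 2) powr (- a))\<^sup>2 * D)
      * (v * (2 ^ j) ^ d) * (2 * 4 ^ j) powr s\<^sub>1 * (2 * 4 ^ j) powr s\<^sub>2
    = (C\<^sub>1 * C\<^sub>2 * (8 * C\<^sub>0\<^sup>2 * D) * v * 2 powr (2 * a + s\<^sub>1 + s\<^sub>2)) * (q ^ j * q ^ j)"
proof -
  have "(2 :: real) ^ j / 2 = 2 powr (real j - 1)"
    by (simp add: powr_diff powr_realpow)
  then have 1: "((2 ^ j / 2) powr (- a))\<^sup>2 = 2 powr (2 * a - 2 * real j * a)"
    by (simp add: powr_powr power2_eq_square algebra_simps flip: powr_add)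
  have 2: "((2 :: real) ^ j) ^ d = 2 powr (real j * real d)"
    by (simp add: powr_realpow flip: power_mult of_nat_mult)
  have "(2 :: real) * 4 ^ j = 2 powr (1 + 2 * real j)"
    by (simp add: powr_add powr_realpow powr_powr[symmetric] flip: powr_realpow)
  then have 3: "((2 :: real) * 4 ^ j) powr s = 2 powr (s + 2 * real j * s)" for s
    by (simp add: powr_powr algebra_simps)
  have 4: "q ^ j * q ^ j = 2 powr (real j * (\<alpha>\<^sub>1 + \<alpha>\<^sub>2 - 2 * a + real d + 2 * s\<^sub>1 + 2 * s\<^sub>2))"
    unfolding q_def by (simp add: powr_power mult.commute flip: powr_add)
  have "2 powr (real j * \<alpha>\<^sub>1) * 2 powr (real j * \<alpha>\<^sub>2) * 2 powr (2 * a - 2 * real j * a) * 2 powr (real j * real d)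
      * 2 powr (s\<^sub>1 + 2 * real j * s\<^sub>1) * 2 powr (s\<^sub>2 + 2 * real j * s\<^sub>2)
      = 2 powr (2 * a + s\<^sub>1 + s\<^sub>2) * (q ^ j * q ^ j)"
    unfolding 4 powr_add[symmetric] by (simp add: algebra_simps)
  then show ?thesis
    unfolding 2 3 power_mult_distrib 1 by (simp add: mult_ac)
qed

theorem biparameter_maximal_L2_bound:
  fixes m :: "'a::euclidean_space \<times> 'a \<Rightarrow> complex"
  assumes E: "E\<^sub>1 \<subseteq> {1..2}" "E\<^sub>2 \<subseteq> {1..2}"
    and dim: "upper_minkowski_dim E\<^sub>1 = ereal \<beta>\<^sub>1" "upper_minkowski_dim E\<^sub>2 = ereal \<beta>\<^sub>2"
    and m: "admissible a 2 m"
    and s: "s\<^sub>1 \<ge> 0" "s\<^sub>2 \<ge> 0" "s\<^sub>1 + s\<^sub>2 < (2 * a - real DIM('a) - \<beta>\<^sub>1 - \<beta>\<^sub>2) / 2"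
  shows "\<exists>C::real. C \<ge> 0 \<and> (\<forall>f \<in> test_functions. \<forall>g \<in> test_functions.
           L2_enorm (biparameter_maximal m E\<^sub>1 E\<^sub>2 f g)
             \<le> ennreal C * sobolev_neg_norm s\<^sub>1 f * sobolev_neg_norm s\<^sub>2 g)"
proof -
  \<comment> \<open>A quarter of the available gap. Two losses of \<epsilon> from the coverings use
    half of it, leaving \<theta> = - 2 \<epsilon> and q = 2^(-\<epsilon>).\<close>
  define \<epsilon> where "\<epsilon> = (2 * a - real DIM('a) - \<beta>\<^sub>1 - \<beta>\<^sub>2 - 2 * (s\<^sub>1 + s\<^sub>2)) / 4"
  have "\<epsilon> > 0" using s unfolding \<epsilon>_def by simp
  define \<theta> where "\<theta> = (\<beta>\<^sub>1 + \<epsilon>) + (\<beta>\<^sub>2 + \<epsilon>) - 2 * a + real DIM('a) + 2 * s\<^sub>1 + 2 * s\<^sub>2"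
  have "\<theta> < 0" using \<open>\<epsilon> > 0\<close> unfolding \<theta>_def \<epsilon>_def by (simp add: field_simps)
  define q where "q = 2 powr (\<theta> / 2)"
  have q: "0 < q" "q < 1" unfolding q_def using \<open>\<theta> < 0\<close> by (simp_all add: powr_less_one)
  have a: "a \<ge> 0" and Ck: "C_k 2 m"
    using m of_nat_0_le_iff[of "DIM('a)", where 'a = real] unfolding admissible_def by linarith+
  obtain C\<^sub>0 where C0: "C\<^sub>0 \<ge> 0" "\<And>bs z. set bs \<subseteq> Basis \<Longrightarrow> length bs \<le> 2 \<Longrightarrow>
      cmod (iterated_partial bs m z) \<le> C\<^sub>0 * (1 + norm (fst z) + norm (snd z)) powr (- a)"
    using admissible_uniform_decay[OF m] by blast
  obtain C\<^sub>1 where C1: "C\<^sub>1 > 0" "\<And>j. real (covering_number E\<^sub>1 ((1/2) ^ j)) \<le> C\<^sub>1 * 2 powr (real j * (\<beta>\<^sub>1 + \<epsilon>))"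
    using covering_number_growth[OF dim(1) \<open>\<epsilon> > 0\<close>] by blast
  obtain C\<^sub>2 where C2: "C\<^sub>2 > 0" "\<And>j. real (covering_number E\<^sub>2 ((1/2) ^ j)) \<le> C\<^sub>2 * 2 powr (real j * (\<beta>\<^sub>2 + \<epsilon>))"
    using covering_number_growth[OF dim(2) \<open>\<epsilon> > 0\<close>] by blast
  define D where "D = (1 + (real DIM('a))\<^sup>2)\<^sup>2"
  define v where "v = unit_ball_vol (real DIM('a))"
  have D: "D \<ge> 0" and v: "v \<ge> 0" unfolding D_def v_def by simp_all
  define K where "K = C\<^sub>1 * C\<^sub>2 * (8 * C\<^sub>0\<^sup>2 * D) * v * 2 powr (2 * a + s\<^sub>1 + s\<^sub>2)"
  have K: "K \<ge> 0" unfolding K_def using C1 C2 D v by simp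
  \<comment> \<open>One factor 1 / (1 - q) comes from Cauchy-Schwarz over the shells, the other from
    the geometric series that remains; the root is taken because the estimate is for
    squares.\<close>
  define C where "C = sqrt (K / (1 - q)\<^sup>2)"
  show ?thesis
  proof (intro exI[of _ C] conjI ballI)
    show "C \<ge> 0" unfolding C_def using K by simp
    fix f g :: "'a \<Rightarrow> complex" assume fg: "f \<in> test_functions" "g \<in> test_functions"
    let ?F = "fourier f" and ?G = "fourier g"
    let ?NF = "(sobolev_neg_norm s\<^sub>1 f)\<^sup>2" and ?NG = "(sobolev_neg_norm s\<^sub>2 g)\<^sup>2"
    let ?L = "\<lambda>j t\<^sub>1 t\<^sub>2 x. ennreal (cmod (localized_bilinear (frequency_shell j) ?F ?G (dilate t\<^sub>1 t\<^sub>2 m) x))"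
    note meas [measurable] = fourier_test_function(1)[OF fg(1)] fourier_test_function(1)[OF fg(2)]
    have "\<forall>j. \<exists>S. S \<in> borel_measurable (borel :: 'a measure)
        \<and> (\<forall>t\<^sub>1\<in>E\<^sub>1. \<forall>t\<^sub>2\<in>E\<^sub>2. \<forall>x. (?L j t\<^sub>1 t\<^sub>2 x)\<^sup>2 \<le> S x)
        \<and> (\<integral>\<^sup>+x. S x \<partial>lborel) \<le> ennreal (real (covering_number E\<^sub>1 ((1/2) ^ j)) * real (covering_number E\<^sub>2 ((1/2) ^ j))
            * (8 * (C\<^sub>0 * (2 ^ j / 2) powr (- a))\<^sup>2 * D))
          * (emeasure lborel (cball 0 (2 ^ j) :: 'a set) * local_energy ?F (2 ^ j) * local_energy ?G (2 ^ j))"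
      unfolding D_def
      by (intro allI shell_maximal_bound[OF Ck a C0 E meas fourier_test_function(2)[OF fg(1)] fourier_test_function(2)[OF fg(2)]])
    from choice[OF this] obtain S where S [measurable]: "\<And>j. S j \<in> borel_measurable (borel :: 'a measure)"
      and S_le: "\<And>j t\<^sub>1 t\<^sub>2 x. t\<^sub>1 \<in> E\<^sub>1 \<Longrightarrow> t\<^sub>2 \<in> E\<^sub>2 \<Longrightarrow> (?L j t\<^sub>1 t\<^sub>2 x)\<^sup>2 \<le> S j x"
      and S_int: "\<And>j. (\<integral>\<^sup>+x. S j x \<partial>lborel) \<le> ennreal (real (covering_number E\<^sub>1 ((1/2) ^ j)) * real (covering_number E\<^sub>2 ((1/2) ^ j))
            * (8 * (C\<^sub>0 * (2 ^ j / 2) powr (- a))\<^sup>2 * D))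
          * (emeasure lborel (cball 0 (2 ^ j) :: 'a set) * local_energy ?F (2 ^ j) * local_energy ?G (2 ^ j))"
      by blast
    have S_bound: "(\<integral>\<^sup>+x. S j x \<partial>lborel) \<le> ennreal (K * (q ^ j * q ^ j)) * (?NF * ?NG)" for j
    proof -
      let ?W = "8 * (C\<^sub>0 * (2 ^ j / 2) powr (- a))\<^sup>2 * D"
      let ?c1 = "C\<^sub>1 * 2 powr (real j * (\<beta>\<^sub>1 + \<epsilon>))" and ?c2 = "C\<^sub>2 * 2 powr (real j * (\<beta>\<^sub>2 + \<epsilon>))"
      let ?e1 = "(2 * 4 ^ j) powr s\<^sub>1 :: real" and ?e2 = "(2 * 4 ^ j) powr s\<^sub>2 :: real"
      have vol: "emeasure lborel (cball 0 (2 ^ j) :: 'a set) = ennreal (v * (2 ^ j) ^ DIM('a))"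
        unfolding v_def by (rule emeasure_cball) simp
      have "(\<integral>\<^sup>+x. S j x \<partial>lborel) \<le> ennreal (?c1 * ?c2 * ?W)
          * (ennreal (v * (2 ^ j) ^ DIM('a)) * (ennreal ?e1 * ?NF) * (ennreal ?e2 * ?NG))"
        using C1 C2 D s unfolding vol[symmetric]
        by (intro order.trans[OF S_int] mult_mono ennreal_leI local_energy_le_sobolev meas) auto
      also have "\<dots> = ennreal (?c1 * ?c2 * ?W * (v * (2 ^ j) ^ DIM('a)) * ?e1 * ?e2) * (?NF * ?NG)"
        using C1 C2 D v by (simp add: ennreal_mult mult_ac)
      also have "?c1 * ?c2 * ?W * (v * (2 ^ j) ^ DIM('a)) * ?e1 * ?e2 = K * (q ^ j * q ^ j)"
        unfolding dyadic_constants K_def q_def \<theta>_def by simp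
      finally show ?thesis .
    qed
    define R where "R = (\<lambda>x. ennreal (1 / (1 - q)) * (\<Sum>j. ennreal ((1 / q) ^ j) * S j x))"
    have pt: "(biparameter_maximal m E\<^sub>1 E\<^sub>2 f g x)\<^sup>2 \<le> R x" for x
      unfolding biparameter_maximal_def
    proof (rule SUP_power2_le, clarify)
      fix t\<^sub>1 t\<^sub>2 assume t: "t\<^sub>1 \<in> E\<^sub>1" "t\<^sub>2 \<in> E\<^sub>2"
      have "(ennreal (cmod (bilinear_operator (dilate t\<^sub>1 t\<^sub>2 m) f g x)))\<^sup>2 \<le> (\<Sum>j. ?L j t\<^sub>1 t\<^sub>2 x)\<^sup>2"
        by (intro power_mono bilinear_operator_le_shells) simp
      also have "\<dots> \<le> ennreal (1 / (1 - q)) * (\<Sum>j. ennreal ((1 / q) ^ j) * (?L j t\<^sub>1 t\<^sub>2 x)\<^sup>2)"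
        by (rule suminf_power2_le[OF q])
      also have "\<dots> \<le> R x"
        unfolding R_def by (intro mult_left_mono suminf_le S_le t summableI) auto
      finally show "(ennreal (cmod (bilinear_operator (dilate t\<^sub>1 t\<^sub>2 m) f g x)))\<^sup>2 \<le> R x" .
    qed
    \<comment> \<open>For the maximal function itself only the monotonicity of the lower integral is
      invoked; the exchange of series and integral that follows concerns the measurable
      \<open>S j\<close>.\<close>
    have "(L2_enorm (biparameter_maximal m E\<^sub>1 E\<^sub>2 f g))\<^sup>2 \<le> (\<integral>\<^sup>+x. R x \<partial>lborel)"
      unfolding L2_enorm_power2 by (intro nn_integral_mono pt)
    also have "\<dots> = ennreal (1 / (1 - q)) * (\<Sum>j. ennreal ((1 / q) ^ j) * (\<integral>\<^sup>+x. S j x \<partial>lborel))"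
      unfolding R_def by (simp add: nn_integral_cmult nn_integral_suminf)
    also have "\<dots> \<le> ennreal (1 / (1 - q)) * (\<Sum>j. ennreal ((1 / q) ^ j) * (ennreal (K * (q ^ j * q ^ j)) * (?NF * ?NG)))"
      by (intro mult_left_mono suminf_le S_bound summableI) auto
    \<comment> \<open>The weight q^(-j) consumes half of the decay q^(2j), and a convergent
      geometric series remains.\<close>
    also have "(\<lambda>j. ennreal ((1 / q) ^ j) * (ennreal (K * (q ^ j * q ^ j)) * (?NF * ?NG)))
        = (\<lambda>j. ennreal (q ^ j) * (ennreal K * (?NF * ?NG)))"
    proof
      fix j
      have "ennreal ((1 / q) ^ j) * ennreal (K * (q ^ j * q ^ j)) = ennreal ((1 / q) ^ j * (K * (q ^ j * q ^ j)))"
        using q K by (intro ennreal_mult[symmetric]) auto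
      also have "(1 / q) ^ j * (K * (q ^ j * q ^ j)) = q ^ j * K"
        using q by (simp add: power_one_over)
      also have "ennreal (q ^ j * K) = ennreal (q ^ j) * ennreal K"
        using q K by (intro ennreal_mult) auto
      finally show "ennreal ((1 / q) ^ j) * (ennreal (K * (q ^ j * q ^ j)) * (?NF * ?NG))
          = ennreal (q ^ j) * (ennreal K * (?NF * ?NG))"
        by (metis mult.assoc)
    qed
    also have "(\<Sum>j. ennreal (q ^ j) * (ennreal K * (?NF * ?NG))) = ennreal (1 / (1 - q)) * (ennreal K * (?NF * ?NG))"
      unfolding ennreal_suminf_multc using q
      by (subst suminf_ennreal2) (auto simp: summable_geometric suminf_geometric)
    also have "ennreal (1 / (1 - q)) * (ennreal (1 / (1 - q)) * (ennreal K * (?NF * ?NG)))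
        = ennreal (K / (1 - q)\<^sup>2) * (?NF * ?NG)"
      using q K by (simp add: mult.assoc[symmetric] ennreal_mult[symmetric] power2_eq_square)
    also have "\<dots> = (ennreal C * sobolev_neg_norm s\<^sub>1 f * sobolev_neg_norm s\<^sub>2 g)\<^sup>2"
      using K unfolding C_def by (simp add: power_mult_distrib ennreal_power mult.assoc)
    finally show "L2_enorm (biparameter_maximal m E\<^sub>1 E\<^sub>2 f g)
        \<le> ennreal C * sobolev_neg_norm s\<^sub>1 f * sobolev_neg_norm s\<^sub>2 g"
      by (rule ennreal_power2_le_imp_le)
  qed
qed

theorem corollary4p2:
  fixes m :: "(real ^ 'n) \<times> (real ^ 'n) \<Rightarrow> complex"
    and E\<^sub>1 E\<^sub>2 :: "real set"
    and a \<beta>\<^sub>1 \<beta>\<^sub>2 s\<^sub>1 s\<^sub>2 :: real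
  assumes "E\<^sub>1 \<subseteq> {1..2}" and "E\<^sub>1 \<noteq> {}" and "upper_minkowski_dim E\<^sub>1 = ereal \<beta>\<^sub>1"
    and "E\<^sub>2 \<subseteq> {1..2}" and "E\<^sub>2 \<noteq> {}" and "upper_minkowski_dim E\<^sub>2 = ereal \<beta>\<^sub>2"
    and "admissible a 2 m"
    and "2 * a > real CARD('n) + \<beta>\<^sub>1 + \<beta>\<^sub>2"
    and "s\<^sub>1 \<ge> 0" and "s\<^sub>2 \<ge> 0"
    and "s\<^sub>1 + s\<^sub>2 < (2 * a - real CARD('n) - \<beta>\<^sub>1 - \<beta>\<^sub>2) / 2"
  shows "\<exists>C::real. C \<ge> 0 \<and> (\<forall>f \<in> test_functions. \<forall>g \<in> test_functions.
           L2_enorm (biparameter_maximal m E\<^sub>1 E\<^sub>2 f g)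
             \<le> ennreal C * sobolev_neg_norm s\<^sub>1 f * sobolev_neg_norm s\<^sub>2 g)"
  using assms by (intro biparameter_maximal_L2_bound[where a = a and \<beta>\<^sub>1 = \<beta>\<^sub>1 and \<beta>\<^sub>2 = \<beta>\<^sub>2]) auto

end
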